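(* Let $H$ and $U$ be Hilbert spaces, let $A$ generate a $C_0$ semigroup on $H$, let $B\in\mathcal{L}(U;H)$, and let $T>0$. Let $\mathcal{G}$ be a closed vector subspace of $L^2(0,T;U)$ and $\mathcal{W}$ a closed vector subspace of $L^2(0,T;H)$, both of finite dimension. Assume that there exists $\tilde T\in(0,T]$ such that the following two properties hold: (i) if, for some $(z_{\tilde T},g,w)\in H\times\mathcal{G}\times\mathcal{W}$, the solution $z$ of $z'+A^*z=w$ for $t\in(0,\tilde T)$, $z(\tilde T)=z_{\tilde T}$, satisfies $B^*z=g$ for $t\in(0,\tilde T)$, then $z_{\tilde T}=0$, $g=0$ and $w=0$ (the last two equalities being understood on the whole interval $(0,T)$); (ii) there exists a constant $C$ such that for every $z_T\in H$, the solution $z$ of $z'+A^*z=0$ for $t\in(0,T)$, $z(T)=z_T$, satisfies $$\|z(\tilde T)\|_H\le C\,\|B^*z\|_{L^2(0,T;U)}.$$ Then there exists a constant $C>0$ such that for all $(z_T,g,w,f)\in H\times\mathcal{G}\times\mathcal{W}\times L^2(0,T;H)$, the solution $z$ of $z'+A^*z=f$ for $t\in(0,T)$, $z(T)=z_T$, satisfies $$\|(z(0),g,w,f)\|_{H\times\mathcal{G}\times\mathcal{W}\times L^2(0,T;H)}\le C\left(\|B^*z+g\|_{L^2(0,T;U)}+\|f+w\|_{L^2(0,T;H)}\right).$$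
   Context: $\mathcal{G}$ and $\mathcal{W}$ carry the norms of $L^2(0,T;U)$ and $L^2(0,T;H)$. Solutions of the evolution equations are the usual mild (semigroup) solutions, continuous in time with values in $H$; the equations for $z$ are solved backward in time from the prescribed final value. $A^*$, $B^*$ denote adjoints. *)

theory Defs
  imports "HOL-Analysis.Analysis"
begin

text \<open>
  Hilbert spaces are types of sort \<open>{real_inner, complete_space}\<close>; no separability is
  assumed.  A complex Hilbert space is covered through the real part of its inner product: this
  changes neither norms nor (for complex linear operators) adjoints, and a finite-dimensional
  complex subspace is a finite-dimensional real one.
\<close>

subsection \<open>The spaces \<open>L\<^sup>2(0,T;X)\<close>\<close>

text \<open>
  Bochner measurability.  The Bochner integral of the library requires a second countable
  codomain, hence the explicit definition.
\<close>

definition strongly_measurable :: "'a measure \<Rightarrow> ('a \<Rightarrow> 'b::real_normed_vector) \<Rightarrow> bool" where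
  "strongly_measurable M f \<longleftrightarrow>
     (\<exists>s. (\<forall>n::nat. simple_function M (s n)) \<and> (AE x in M. (\<lambda>n. s n x) \<longlonglongrightarrow> f x))"

abbreviation time_measure :: "real \<Rightarrow> real measure" where
  "time_measure T \<equiv> lebesgue_on {0<..<T}"

text \<open>
  Elements of \<open>L\<^sup>2(0,T;X)\<close> are represented by functions rather than by classes modulo equality
  almost everywhere.
\<close>

definition L2 :: "real \<Rightarrow> (real \<Rightarrow> 'b::real_normed_vector) set" where
  "L2 T = {f. strongly_measurable (time_measure T) f \<and>
              integrable (time_measure T) (\<lambda>t. (norm (f t))\<^sup>2)}"

definition L2_norm :: "real \<Rightarrow> (real \<Rightarrow> 'b::real_normed_vector) \<Rightarrow> real" where
  "L2_norm T f = sqrt (\<integral>t. (norm (f t))\<^sup>2 \<partial>time_measure T)"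

text \<open>
  Closedness forces such a set to be saturated under equality almost everywhere on \<open>(0,T)\<close>
  (take constant sequences), so these sets correspond exactly to the closed vector subspaces of
  the space of classes.
\<close>

definition closed_subspace_L2 :: "real \<Rightarrow> (real \<Rightarrow> 'b::real_normed_vector) set \<Rightarrow> bool" where
  "closed_subspace_L2 T V \<longleftrightarrow>
     V \<subseteq> L2 T \<and>
     (\<lambda>t. 0) \<in> V \<and>
     (\<forall>f\<in>V. \<forall>g\<in>V. (\<lambda>t. f t + g t) \<in> V) \<and>
     (\<forall>c. \<forall>f\<in>V. (\<lambda>t. c *\<^sub>R f t) \<in> V) \<and>
     (\<forall>s f. (\<forall>n::nat. s n \<in> V) \<and> f \<in> L2 T \<and> (\<lambda>n. L2_norm T (\<lambda>t. s n t - f t)) \<longlonglongrightarrow> 0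
        \<longrightarrow> f \<in> V)"

definition finite_dim_L2 :: "real \<Rightarrow> (real \<Rightarrow> 'b::real_normed_vector) set \<Rightarrow> bool" where
  "finite_dim_L2 T V \<longleftrightarrow>
     (\<exists>E. finite E \<and> E \<subseteq> V \<and>
        (\<forall>f\<in>V. \<exists>c. AE t in time_measure T. f t = (\<Sum>e\<in>E. c e *\<^sub>R e t)))"

subsection \<open>Semigroups and generators\<close>

text \<open>Only the values \<open>S t\<close> with \<open>t \<ge> 0\<close> are meaningful.\<close>

definition C0_semigroup :: "(real \<Rightarrow> 'a \<Rightarrow> 'a::real_normed_vector) \<Rightarrow> bool" where
  "C0_semigroup S \<longleftrightarrow>
     (\<forall>t\<ge>0. bounded_linear (S t)) \<and>
     (\<forall>x. S 0 x = x) \<and>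
     (\<forall>s\<ge>0. \<forall>t\<ge>0. \<forall>x. S (s + t) x = S s (S t x)) \<and>
     (\<forall>x. ((\<lambda>t. S t x) \<longlongrightarrow> x) (at_right 0))"

text \<open>Unbounded operators are identified with their graphs.\<close>

definition generator :: "(real \<Rightarrow> 'a \<Rightarrow> 'a::real_normed_vector) \<Rightarrow> ('a \<times> 'a) set" where
  "generator S = {(x, y). ((\<lambda>t. (1 / t) *\<^sub>R (S t x - x)) \<longlongrightarrow> y) (at_right 0)}"

definition generates :: "('a \<times> 'a) set \<Rightarrow> (real \<Rightarrow> 'a \<Rightarrow> 'a::real_normed_vector) \<Rightarrow> bool" where
  "generates A S \<longleftrightarrow> C0_semigroup S \<and> generator S = A"

text \<open>This is the graph of the adjoint when the domain of \<open>A\<close> is dense.\<close>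

definition adjoint_graph :: "('a \<times> 'a) set \<Rightarrow> ('a \<times> 'a::real_inner) set" where
  "adjoint_graph A = {(y, y'). \<forall>(x, x')\<in>A. x' \<bullet> y = x \<bullet> y'}"

subsection \<open>Mild solutions\<close>

text \<open>
  \<open>z\<close> is the mild solution of \<open>z' + L z = f\<close> on \<open>(0,\<tau>)\<close> with \<open>z(\<tau>) = z\<^sub>\<tau>\<close>, solved backward in
  time: \<open>z(t) = R(\<tau> - t) z\<^sub>\<tau> - \<integral>\<^sub>t\<^sup>\<tau> R(s - t) f(s) ds\<close>, where \<open>R\<close> is the (unique) \<open>C\<^sub>0\<close> semigroup
  generated by \<open>L\<close>.  For \<open>f\<close> in \<open>L\<^sup>2\<close> the integrand is Bochner integrable, and its Bochner integral
  is its Henstock-Kurzweil integral.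
\<close>

definition mild_solution ::
  "('a \<times> 'a) set \<Rightarrow> real \<Rightarrow> 'a \<Rightarrow> (real \<Rightarrow> 'a) \<Rightarrow> (real \<Rightarrow> 'a::real_normed_vector) \<Rightarrow> bool" where
  "mild_solution L \<tau> z\<^sub>\<tau> f z \<longleftrightarrow>
     (\<exists>R. generates L R \<and>
        continuous_on {0..\<tau>} z \<and>
        (\<forall>t\<in>{0..\<tau>}. ((\<lambda>s. R (s - t) (f s)) has_integral (R (\<tau> - t) z\<^sub>\<tau> - z t)) {t..\<tau>}))"

end

theory Submission
  imports Defs
begin

text \<open>
  The proof is a compactness--uniqueness argument in which finite dimension plays the part of
  compactness.  Write \<open>C\<close> for the adjoint of \<open>B\<close>.  All solutions are driven by one and the same
  semigroup \<open>R\<close>, because a \<open>C\<^sub>0\<close> semigroup is determined by its generator (\<open>semigroup_unique\<close>);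
  \<open>mild_for\<close> is the notion of solution with \<open>R\<close> fixed.

  By Duhamel's formula, hypothesis (ii) extends to solutions with a source:
  \<open>\<parallel>z \<tau>\<parallel> \<le> K (\<parallel>C z\<parallel> + \<parallel>f\<parallel>)\<close> (\<open>observability_with_source\<close>).  As \<open>z 0\<close> is controlled by \<open>z \<tau>\<close> and \<open>f\<close>,
  and as \<open>\<parallel>C z\<parallel>\<close> and \<open>\<parallel>f\<parallel>\<close> are at most \<open>\<parallel>C z + g\<parallel> + \<parallel>g\<parallel>\<close> and \<open>\<parallel>f + w\<parallel> + \<parallel>w\<parallel>\<close>, it remains to bound
  \<open>\<parallel>g\<parallel> + \<parallel>w\<parallel>\<close> by \<open>\<parallel>C z + g\<parallel> + \<parallel>f + w\<parallel>\<close>.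

  For fixed \<open>(g, w)\<close> let \<open>P (g, w)\<close> be the infimum of \<open>\<parallel>C z + g\<parallel> + \<parallel>f + w\<parallel>\<close> over all sources \<open>f\<close> and all
  solutions \<open>z\<close>.  This is a seminorm on the finite-dimensional space \<open>G \<times> W\<close>, so the bound follows
  once \<open>P (g, w) = 0\<close> forces \<open>g = 0\<close> and \<open>w = 0\<close> (\<open>finite_dim_le_family\<close>).  If \<open>P (g, w) = 0\<close>, there
  are solutions \<open>z\<^sub>n\<close> with sources \<open>f\<^sub>n \<longlonglongrightarrow> - w\<close> and observations \<open>C z\<^sub>n \<longlonglongrightarrow> - g\<close>.  Their final values
  \<open>z\<^sub>n T\<close> may diverge, but the observability estimate applied to differences makes \<open>z\<^sub>n \<tau>\<close> a Cauchy
  sequence.  Hence \<open>z\<^sub>n\<close> converges uniformly on \<open>[0,\<tau>]\<close> to a solution with source \<open>- w\<close> and observation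
  \<open>- g\<close> (\<open>mild_for_observed_limit\<close>), and hypothesis (i) gives \<open>g = 0\<close> and \<open>w = 0\<close>.
\<close>

section \<open>Adjoints and uniform boundedness\<close>

text \<open>
  The representing vector minimises \<open>x \<bullet> x - 2 * l x\<close>.  The parallelogram law makes every minimising
  sequence Cauchy, and the first variation at the minimiser is the claim.
\<close>

lemma riesz_representation:
  fixes l :: "'a::{real_inner, complete_space} \<Rightarrow> real"
  assumes l: "bounded_linear l"
  obtains a where "\<And>x. l x = a \<bullet> x"
proof -
  interpret l: bounded_linear l by fact
  define J where "J x = x \<bullet> x - 2 * l x" for x
  obtain K where K: "\<And>x. norm (l x) \<le> norm x * K" using l.bounded by blast
  have lower: "- (K\<^sup>2) \<le> J x" for x
  proof -
    have "2 * l x \<le> 2 * (norm x * K)" using K[of x] by auto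
    also have "\<dots> \<le> (norm x)\<^sup>2 + K\<^sup>2" using sum_squares_bound[of "norm x" K] by simp
    finally show ?thesis by (simp add: J_def power2_norm_eq_inner)
  qed
  have bdd: "bdd_below (range J)" using lower by (auto intro!: bdd_belowI)
  define m where "m = Inf (range J)"
  have m: "m \<le> J x" for x unfolding m_def by (rule cInf_lower[OF _ bdd]) auto
  have "\<exists>x. J x < m + 1 / Suc n" for n
    using cInf_lessD[of "range J" "m + 1 / Suc n"] by (auto simp: m_def)
  then obtain X where X: "\<And>n. J (X n) < m + 1 / Suc n" by metis
  \<comment> \<open>the parallelogram law, in which the linear part of \<open>J\<close> cancels\<close>
  have par: "(norm (x - y))\<^sup>2 = 2 * (J x + J y - 2 * J ((1/2) *\<^sub>R (x + y)))" for x y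
    by (simp add: J_def power2_norm_eq_inner l.add l.scaleR algebra_simps inner_commute)
  have close: "(norm (X i - X j))\<^sup>2 \<le> 2 / Suc i + 2 / Suc j" for i j
    using par[of "X i" "X j"] X[of i] X[of j] m[of "(1/2) *\<^sub>R (X i + X j)"] by simp
  have "Cauchy X"
  proof (rule metric_CauchyI)
    fix e :: real assume e: "0 < e"
    obtain N where N: "4 / e\<^sup>2 < real N" using reals_Archimedean2 by blast
    have "dist (X i) (X j) < e" if "N \<le> i" "N \<le> j" for i j
    proof -
      have *: "2 / Suc k < e\<^sup>2 / 2" if "N \<le> k" for k
      proof -
        have "4 / e\<^sup>2 < Suc k" using N that by linarith
        then show ?thesis using e by (simp add: field_simps)
      qed
      have "(norm (X i - X j))\<^sup>2 < e\<^sup>2" using close[of i j] *[OF that(1)] *[OF that(2)] by simp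
      then show ?thesis using e by (simp add: dist_norm power2_less_imp_less)
    qed
    then show "\<exists>M. \<forall>m\<ge>M. \<forall>n\<ge>M. dist (X m) (X n) < e" by blast
  qed
  then obtain a where a: "X \<longlonglongrightarrow> a" using Cauchy_convergent_iff convergent_def by blast
  have "(\<lambda>n. J (X n)) \<longlonglongrightarrow> J a" unfolding J_def by (intro tendsto_intros a l.tendsto)
  moreover have "(\<lambda>n. J (X n)) \<longlonglongrightarrow> m"
  proof (rule tendsto_sandwich[where f="\<lambda>_. m" and h="\<lambda>n. m + 1 / Suc n"])
    show "(\<lambda>n. m + 1 / real (Suc n)) \<longlonglongrightarrow> m"
      using tendsto_add[OF tendsto_const LIMSEQ_inverse_real_of_nat, of m] by (simp add: inverse_eq_divide)
  qed (use X m in \<open>auto intro!: always_eventually less_imp_le\<close>)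
  ultimately have Ja: "J a = m" using LIMSEQ_unique by blast
  have "l v = a \<bullet> v" for v
  proof (rule ccontr)
    define d where "d = a \<bullet> v - l v"
    assume "l v \<noteq> a \<bullet> v"
    then have d: "d \<noteq> 0" by (simp add: d_def)
    have v: "0 < v \<bullet> v" using d by (cases "v = 0") (auto simp: d_def l.zero)
    have "J (a + t *\<^sub>R v) = m + 2 * t * d + t\<^sup>2 * (v \<bullet> v)" for t
      by (simp add: Ja[symmetric] J_def d_def l.add l.scaleR algebra_simps inner_commute power2_eq_square)
    \<comment> \<open>the minimum of the quadratic polynomial in \<open>t\<close>\<close>
    from this[of "- d / (v \<bullet> v)"] have "J (a + (- d / (v \<bullet> v)) *\<^sub>R v) = m - d\<^sup>2 / (v \<bullet> v)"
      using v by (simp add: field_simps power2_eq_square)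
    then show False using m[of "a + (- d / (v \<bullet> v)) *\<^sub>R v"] d v
      by (smt (verit) divide_pos_pos zero_less_power2)
  qed
  then show thesis using that by blast
qed

lemma inner_adjoint:
  fixes B :: "'a::{real_inner, complete_space} \<Rightarrow> 'b::real_inner"
  assumes "bounded_linear B"
  shows "B x \<bullet> y = x \<bullet> adjoint B y"
proof -
  have "\<exists>a. \<forall>x. B x \<bullet> y = x \<bullet> a" for y
  proof -
    have "bounded_linear (\<lambda>x. B x \<bullet> y)"
      using bounded_linear_compose[OF bounded_linear_inner_left assms] .
    from riesz_representation[OF this] show ?thesis by (metis inner_commute)
  qed
  then obtain f where "\<forall>x y. B x \<bullet> y = x \<bullet> f y" by metis
  then have "\<forall>x y. B x \<bullet> y = x \<bullet> adjoint B y"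
    unfolding adjoint_def by (rule someI[where P = "\<lambda>f'. \<forall>x y. B x \<bullet> y = x \<bullet> f' y"])
  then show ?thesis by blast
qed

lemma bounded_linear_adjoint:
  fixes B :: "'a::{real_inner, complete_space} \<Rightarrow> 'b::real_inner"
  assumes B: "bounded_linear B"
  shows "bounded_linear (adjoint B)"
proof -
  note adj = inner_adjoint[OF B]
  have eq: "a = b" if "\<And>x. x \<bullet> a = x \<bullet> b" for a b :: 'a
    using that vector_eq_ldot by blast
  obtain K where K0: "0 \<le> K" and K: "\<And>x. norm (B x) \<le> norm x * K"
    using bounded_linear.nonneg_bounded[OF B] by blast
  show ?thesis
  proof (rule bounded_linear_intro)
    show "adjoint B (x + y) = adjoint B x + adjoint B y" for x y
      by (rule eq) (simp add: adj[symmetric] inner_add_right)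
    show "adjoint B (r *\<^sub>R x) = r *\<^sub>R adjoint B x" for r x
      by (rule eq) (simp add: adj[symmetric])
    show "norm (adjoint B y) \<le> norm y * K" for y
    proof (cases "adjoint B y = 0")
      case True
      then show ?thesis using K0 by simp
    next
      case False
      have "(norm (adjoint B y))\<^sup>2 = B (adjoint B y) \<bullet> y" by (simp add: adj power2_norm_eq_inner)
      also have "\<dots> \<le> norm (B (adjoint B y)) * norm y" by (rule norm_cauchy_schwarz)
      also have "\<dots> \<le> (norm (adjoint B y) * K) * norm y" by (intro mult_right_mono K) auto
      finally have "norm (adjoint B y) * norm (adjoint B y) \<le> norm (adjoint B y) * (norm y * K)"
        by (simp add: power2_eq_square mult_ac)
      then show ?thesis using False by simp
    qed
  qed
qed

text \<open>
  By Baire's theorem one of the closed sets on which the family is bounded by \<open>k\<close> contains a ball;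
  linearity carries the bound on this ball to all vectors.
\<close>

lemma uniform_boundedness:
  fixes F :: "'i \<Rightarrow> 'a::{real_normed_vector, complete_space} \<Rightarrow> 'b::real_normed_vector"
  assumes lin: "\<And>i. bounded_linear (F i)" and bd: "\<And>x. \<exists>K. \<forall>i. norm (F i x) \<le> K"
  obtains K where "\<And>i x. norm (F i x) \<le> K * norm x"
proof -
  define C where "C k = {x. \<forall>i. norm (F i x) \<le> real k}" for k :: nat
  have cl: "closed (C k)" for k
    unfolding C_def by (intro closed_Collect_all closed_Collect_le continuous_on_norm
        linear_continuous_on lin continuous_on_const)
  have "x \<in> \<Union>(range C)" for x
  proof -
    obtain K where "\<forall>i. norm (F i x) \<le> K" using bd by blast
    moreover obtain k :: nat where "K \<le> real k" using real_arch_simple by blast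
    ultimately have "x \<in> C k" unfolding C_def using order_trans by blast
    then show ?thesis by blast
  qed
  then have "euclidean interior_of \<Union>(range C) = (UNIV :: 'a set)"
    by (metis UNIV_eq_I euclidean_interior_of interior_UNIV)
  moreover have "countable (range C)" by simp
  ultimately have "\<not> (\<forall>S\<in>range C. closedin euclidean S \<and> euclidean interior_of S = {})"
    using Baire_category_alt[of "euclidean :: 'a topology" "range C"]
      completely_metrizable_space_euclidean by (metis UNIV_not_empty)
  then obtain k x where "x \<in> interior (C k)" using cl by (auto simp: closed_closedin[symmetric])
  then obtain e where e: "0 < e" "ball x e \<subseteq> C k" by (meson mem_interior)
  have "norm (F i y) \<le> (4 * real k / e) * norm y" for i y
  proof (cases "y = 0")
    case True
    then show ?thesis by (simp add: linear_simps(3)[OF lin])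
  next
    case False
    interpret bounded_linear "F i" by (rule lin)
    define u where "u = (e / (2 * norm y)) *\<^sub>R y"
    have "norm u = e / 2" using False e by (simp add: u_def)
    then have "x + u \<in> ball x e" "x \<in> ball x e" using e by (auto simp: dist_norm)
    then have "x + u \<in> C k" "x \<in> C k" using e(2) by blast+
    then have "norm (F i (x + u)) \<le> k" "norm (F i x) \<le> k" by (auto simp: C_def)
    then have "norm (F i u) \<le> 2 * k" using norm_triangle_ineq4[of "F i (x + u)" "F i x"] by (simp add: add)
    then have "(e / (2 * norm y)) * norm (F i y) \<le> 2 * k" using e by (simp add: u_def scaleR)
    then show ?thesis using e False by (simp add: field_simps)
  qed
  then show thesis using that by blast
qed

section \<open>Semigroups are determined by their generators\<close>

lemma C0_semigroup_tendsto_0: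
  assumes "C0_semigroup S"
  shows "((\<lambda>t. S t x) \<longlongrightarrow> x) (at 0 within {0..})"
  using assms by (simp add: C0_semigroup_def at_within_Ici_at_right)

lemma C0_semigroup_add:
  assumes "C0_semigroup S" "0 \<le> s" "0 \<le> t"
  shows "S (s + t) x = S s (S t x)"
  using assms by (simp add: C0_semigroup_def)

text \<open>
  If the bound failed near \<open>0\<close>, it would fail along some sequence of times tending to \<open>0\<close>; but along
  such a sequence every orbit converges, which contradicts uniform boundedness.  The semigroup law
  propagates the bound from a short interval to \<open>[0,b]\<close>.
\<close>

lemma C0_semigroup_bounded:
  fixes S :: "real \<Rightarrow> 'a \<Rightarrow> 'a::{real_normed_vector, complete_space}"
  assumes S: "C0_semigroup S"
  obtains M where "0 < M" "\<And>t x. 0 \<le> t \<Longrightarrow> t \<le> b \<Longrightarrow> norm (S t x) \<le> M * norm x"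
proof -
  have lin: "bounded_linear (S t)" if "0 \<le> t" for t using S that by (simp add: C0_semigroup_def)
  have "\<exists>n. \<forall>t\<in>{0..1 / Suc n}. \<forall>x. norm (S t x) \<le> real n * norm x"
  proof (rule ccontr)
    assume "\<not> ?thesis"
    then have "\<forall>n. \<exists>t x. t \<in> {0..1 / Suc n} \<and> real n * norm x < norm (S t x)"
      by (meson not_le)
    then obtain \<theta> X where \<theta>: "\<And>n. \<theta> n \<in> {0..1 / Suc n}"
      and X: "\<And>n. real n * norm (X n) < norm (S (\<theta> n) (X n))" by metis
    have "\<theta> \<longlonglongrightarrow> 0"
    proof (rule tendsto_sandwich[where f="\<lambda>_. 0" and h="\<lambda>n. 1 / Suc n"])
      show "(\<lambda>n. 1 / real (Suc n)) \<longlonglongrightarrow> 0"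
        using LIMSEQ_inverse_real_of_nat by (simp add: inverse_eq_divide)
    qed (use \<theta> in auto)
    have conv: "(\<lambda>n. S (\<theta> n) x) \<longlonglongrightarrow> x" for x
    proof -
      have "continuous (at 0 within {0..}) (\<lambda>t. S t x)"
        using C0_semigroup_tendsto_0[OF S, of x] S by (simp add: continuous_within C0_semigroup_def)
      then have "(\<lambda>n. S (\<theta> n) x) \<longlonglongrightarrow> S 0 x"
      proof (rule continuous_within_tendsto_compose'[OF _ _ \<open>\<theta> \<longlonglongrightarrow> 0\<close>])
        show "\<theta> n \<in> {0..}" for n using \<theta>[of n] by simp
      qed
      then show ?thesis using S by (simp add: C0_semigroup_def)
    qed
    have "\<exists>K. \<forall>n. norm (S (\<theta> n) x) \<le> K" for x
      using convergent_imp_Bseq[OF convergentI[OF conv[of x]]] unfolding Bseq_def by blast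
    moreover have "bounded_linear (S (\<theta> n))" for n using lin \<theta> by simp
    ultimately obtain K where K: "\<And>n x. norm (S (\<theta> n) x) \<le> K * norm x"
      using uniform_boundedness[of "\<lambda>n. S (\<theta> n)"] by metis
    obtain n :: nat where "K \<le> n" using real_arch_simple by blast
    then have "norm (S (\<theta> n) (X n)) \<le> n * norm (X n)"
      using K[of n "X n"] by (meson mult_right_mono norm_ge_zero order_trans)
    then show False using X[of n] by simp
  qed
  then obtain n where n: "\<And>t x. 0 \<le> t \<Longrightarrow> t \<le> 1 / Suc n \<Longrightarrow> norm (S t x) \<le> real n * norm x"
    unfolding Ball_def atLeastAtMost_iff by blast
  define d where "d = 1 / real (Suc n)"
  have d: "0 < d" by (simp add: d_def)
  have n': "norm (S t x) \<le> (real n + 1) * norm x" if "0 \<le> t" "t \<le> d" for t x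
    using n[of t x] that norm_ge_zero[of x] unfolding d_def distrib_right by linarith
  have iter: "norm (S t x) \<le> (real n + 1) ^ Suc k * norm x" if "0 \<le> t" "t \<le> real (Suc k) * d" for t x k
    using that
  proof (induction k arbitrary: t)
    case 0
    then show ?case using n' by simp
  next
    case (Suc k)
    show ?case
    proof (cases "t \<le> d")
      case True
      have "(real n + 1) * norm x \<le> (real n + 1) ^ Suc (Suc k) * norm x"
        by (intro mult_right_mono self_le_power) auto
      then show ?thesis using n'[OF Suc.prems(1) True, of x] by (rule order_trans[rotated])
    next
      case False
      have "S t x = S d (S (t - d) x)"
        using C0_semigroup_add[OF S, of d "t - d"] d False by simp
      then have "norm (S t x) \<le> (real n + 1) * norm (S (t - d) x)" using n' d by simp
      also have "\<dots> \<le> (real n + 1) * ((real n + 1) ^ Suc k * norm x)"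
        using Suc False by (intro mult_left_mono Suc.IH) (auto simp: algebra_simps)
      finally show ?thesis by (simp add: mult_ac)
    qed
  qed
  obtain k :: nat where "b / d \<le> k" using real_arch_simple by blast
  then have "b \<le> real (Suc k) * d" using d by (simp add: field_simps)
  then have "norm (S t x) \<le> (real n + 1) ^ Suc k * norm x" if "0 \<le> t" "t \<le> b" for t x
    using iter that by simp
  moreover have "0 < (real n + 1) ^ Suc k" by simp
  ultimately show thesis using that by blast
qed

lemma C0_semigroup_orbit_continuous:
  fixes S :: "real \<Rightarrow> 'a \<Rightarrow> 'a::{real_normed_vector, complete_space}"
  assumes S: "C0_semigroup S"
  shows "continuous_on {0..b} (\<lambda>t. S t x)"
proof -
  obtain M where M: "0 < M" "\<And>t x. 0 \<le> t \<Longrightarrow> t \<le> b \<Longrightarrow> norm (S t x) \<le> M * norm x"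
    using C0_semigroup_bounded[OF S, of b] by blast
  have step: "norm (S t x - S s x) \<le> M * norm (S (t - s) x - x)" if "0 \<le> s" "s \<le> t" "t \<le> b" for s t
  proof -
    have lin: "bounded_linear (S s)" using S that by (simp add: C0_semigroup_def)
    have "S t x = S s (S (t - s) x)" using C0_semigroup_add[OF S, of s "t - s"] that by simp
    then have "S t x - S s x = S s (S (t - s) x - x)" by (simp add: linear_simps[OF lin])
    then show ?thesis using M(2)[of s] that by simp
  qed
  show ?thesis
    unfolding continuous_on_iff
  proof (intro ballI allI impI)
    fix t and e :: real assume t: "t \<in> {0..b}" and e: "0 < e"
    have "\<forall>\<^sub>F h in at 0 within {0..}. dist (S h x) x < e / M"
      using tendstoD[OF C0_semigroup_tendsto_0[OF S]] e M by simp
    then obtain d where d: "0 < d" and near: "\<And>h. 0 \<le> h \<Longrightarrow> h \<noteq> 0 \<Longrightarrow> h < d \<Longrightarrow> dist (S h x) x < e / M"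
      unfolding eventually_at by (auto simp: dist_real_def)
    have near': "M * norm (S h x - x) < e" if "0 \<le> h" "h < d" for h
    proof (cases "h = 0")
      case True
      then show ?thesis using S e by (simp add: C0_semigroup_def)
    next
      case False
      then show ?thesis using near[OF that(1) False that(2)] M by (simp add: dist_norm field_simps)
    qed
    have "dist (S s x) (S t x) < e" if s: "s \<in> {0..b}" "dist s t < d" for s
    proof (cases "s \<le> t")
      case True
      have "norm (S t x - S s x) < e"
        using le_less_trans[OF step near', of s t] True s t by (simp add: dist_real_def)
      then show ?thesis by (simp add: dist_norm norm_minus_commute)
    next
      case False
      have "norm (S s x - S t x) < e"
        using le_less_trans[OF step near', of t s] False s t by (simp add: dist_real_def)
      then show ?thesis by (simp add: dist_norm)
    qed
    then show "\<exists>d>0. \<forall>s\<in>{0..b}. dist s t < d \<longrightarrow> dist (S s x) (S t x) < e" using d by blast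
  qed
qed

text \<open>
  The integral of a continuous function, defined by testing against vectors: it is the Riesz
  representative of the integrated inner products.  The sort \<open>{real_inner, complete_space}\<close> is not a
  subsort of \<open>banach\<close>, so that integration theory in \<open>banach\<close> spaces enters through real-valued
  functions.
\<close>

lemma weak_integral:
  fixes g :: "real \<Rightarrow> 'a::{real_inner, complete_space}"
  assumes cont: "continuous_on {a..b} g"
  obtains v where "\<And>y. ((\<lambda>s. g s \<bullet> y) has_integral v \<bullet> y) {a..b}"
proof -
  obtain K where K: "\<And>s. s \<in> {a..b} \<Longrightarrow> norm (g s) \<le> K"
    using compact_imp_bounded[OF compact_continuous_image[OF cont]] unfolding bounded_iff by fastforce
  have int: "(\<lambda>s. g s \<bullet> y) integrable_on {a..b}" for y
    by (intro integrable_continuous_real continuous_intros cont)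
  have "bounded_linear (\<lambda>y. integral {a..b} (\<lambda>s. g s \<bullet> y))"
  proof (rule bounded_linear_intro)
    show "integral {a..b} (\<lambda>s. g s \<bullet> (x + y)) = integral {a..b} (\<lambda>s. g s \<bullet> x) + integral {a..b} (\<lambda>s. g s \<bullet> y)" for x y
      by (simp add: inner_add_right integral_add int)
    show "integral {a..b} (\<lambda>s. g s \<bullet> (r *\<^sub>R y)) = r *\<^sub>R integral {a..b} (\<lambda>s. g s \<bullet> y)" for r y by simp
    show "norm (integral {a..b} (\<lambda>s. g s \<bullet> y)) \<le> norm y * integral {a..b} (\<lambda>_. K)" for y
    proof -
      have "norm (g s \<bullet> y) \<le> norm y * K" if "s \<in> {a..b}" for s
        using order_trans[OF Cauchy_Schwarz_ineq2 mult_right_mono[OF K[OF that] norm_ge_zero]]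
        by (simp add: mult.commute)
      then have "norm (integral {a..b} (\<lambda>s. g s \<bullet> y)) \<le> integral {a..b} (\<lambda>_. norm y * K)"
        by (intro integral_norm_bound_integral int) auto
      moreover have "integral {a..b} (\<lambda>_. norm y * K) = norm y * integral {a..b} (\<lambda>_. K)"
        by (rule integral_mult_right)
      ultimately show ?thesis by (rule ord_le_eq_trans)
    qed
  qed
  from riesz_representation[OF this] obtain v where "\<And>y. integral {a..b} (\<lambda>s. g s \<bullet> y) = v \<bullet> y" by blast
  then show thesis using that integrable_integral[OF int] by metis
qed

text \<open>
  The averages converge in norm and not only weakly: the estimate of the tested difference is
  uniform in the test vector, which may then be taken to be the difference itself.
\<close>

lemma weak_integral_average:
  fixes g :: "real \<Rightarrow> 'a::{real_inner, complete_space}"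
  assumes cont: "continuous_on {a..b} g" and ab: "a < b"
    and v: "\<And>h y. 0 < h \<Longrightarrow> a + h \<le> b \<Longrightarrow> ((\<lambda>s. g s \<bullet> y) has_integral v h \<bullet> y) {a..a + h}"
  shows "((\<lambda>h. (1 / h) *\<^sub>R v h) \<longlongrightarrow> g a) (at_right 0)"
proof (rule tendstoI)
  fix e :: real assume e: "0 < e"
  have "\<exists>d>0. \<forall>s\<in>{a..b}. dist s a < d \<longrightarrow> dist (g s) (g a) < e / 2"
    using cont ab e unfolding continuous_on_iff by (metis atLeastAtMost_iff half_gt_zero less_imp_le order_refl)
  then obtain d where d: "0 < d" "\<And>s. s \<in> {a..b} \<Longrightarrow> dist s a < d \<Longrightarrow> dist (g s) (g a) < e / 2" by blast
  have "dist ((1 / h) *\<^sub>R v h) (g a) < e" if h: "0 < h" "h < min d (b - a)" for h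
  proof -
    define u where "u = v h - h *\<^sub>R g a"
    have "((\<lambda>s. g s \<bullet> u - g a \<bullet> u) has_integral v h \<bullet> u - h *\<^sub>R (g a \<bullet> u)) {a..a + h}"
      using h has_integral_const_real[of "g a \<bullet> u" a "a + h"] by (intro has_integral_diff v) auto
    moreover have "((\<lambda>s. e / 2 * norm u) has_integral h * (e / 2 * norm u)) {a..a + h}"
      using h has_integral_const_real[of "e / 2 * norm u" a "a + h"] by simp
    moreover have "g s \<bullet> u - g a \<bullet> u \<le> e / 2 * norm u" if "s \<in> {a..a + h}" for s
    proof -
      have "g s \<bullet> u - g a \<bullet> u = (g s - g a) \<bullet> u" by (simp add: inner_diff_left)
      also have "\<dots> \<le> norm (g s - g a) * norm u" by (rule norm_cauchy_schwarz)
      also have "\<dots> \<le> e / 2 * norm u"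
        using d(2)[of s] that h by (intro mult_right_mono) (auto simp: dist_norm dist_real_def)
      finally show ?thesis .
    qed
    ultimately have "v h \<bullet> u - h *\<^sub>R (g a \<bullet> u) \<le> h * (e / 2 * norm u)" by (rule has_integral_le)
    moreover have "v h \<bullet> u - h *\<^sub>R (g a \<bullet> u) = norm u * norm u"
      by (metis inner_diff_left inner_scaleR_left power2_eq_square power2_norm_eq_inner real_scaleR_def u_def)
    ultimately have "norm u * norm u \<le> (h * e / 2) * norm u" by simp
    then have "norm u \<le> h * e / 2" using h e by (cases "norm u = 0") auto
    moreover have "(1 / h) *\<^sub>R v h - g a = (1 / h) *\<^sub>R u" using h by (simp add: u_def scaleR_diff_right)
    moreover have "h * e / 2 < h * e" using h e by simp
    ultimately have "norm u < e * h" "norm ((1 / h) *\<^sub>R v h - g a) = norm u / h"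
      using h by (simp_all add: mult.commute)
    then show ?thesis using h by (simp add: dist_norm pos_divide_less_eq)
  qed
  then show "\<forall>\<^sub>F h in at_right 0. dist ((1 / h) *\<^sub>R v h) (g a) < e"
    unfolding eventually_at_right_field using d ab by (intro exI[of _ "min d (b - a)"]) auto
qed

text \<open>
  The averages of an orbit over \<open>[0,d]\<close> approximate \<open>x\<close>.  They belong to the domain, because
  shifting the interval of integration by \<open>h\<close> changes the integral only by two pieces of length
  \<open>h\<close> at its ends.
\<close>

lemma generator_domain_dense:
  fixes S :: "real \<Rightarrow> 'a \<Rightarrow> 'a::{real_inner, complete_space}"
  assumes S: "C0_semigroup S"
  obtains X where "\<And>n::nat. X n \<in> Domain (generator S)" "X \<longlonglongrightarrow> x"
proof -
  have cont: "continuous_on {a..b} (\<lambda>t. S t x)" if "0 \<le> a" for a b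
    using continuous_on_subset[OF C0_semigroup_orbit_continuous[OF S, of b x]] that by auto
  have lin: "bounded_linear (S t)" if "0 \<le> t" for t using S that by (simp add: C0_semigroup_def)
  have "\<exists>v. \<forall>y. ((\<lambda>s. S s x \<bullet> y) has_integral v \<bullet> y) {a..b}" if "0 \<le> a" for a b
    using weak_integral[OF cont[OF that]] by metis
  then obtain V where V: "\<And>a b y. 0 \<le> a \<Longrightarrow> ((\<lambda>s. S s x \<bullet> y) has_integral V a b \<bullet> y) {a..b}"
    by metis
  have avg: "((\<lambda>h. (1 / h) *\<^sub>R V a (a + h)) \<longlongrightarrow> S a x) (at_right 0)" if "0 \<le> a" for a
    using weak_integral_average[of a "a + 1" "\<lambda>s. S s x" "\<lambda>h. V a (a + h)"] cont V that by simp
  have dom: "V 0 d \<in> Domain (generator S)" if d: "0 < d" for d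
  proof -
    have eq: "S h (V 0 d) - V 0 d = V d (d + h) - V 0 h" if h: "0 < h" for h
    proof -
      have "(S h (V 0 d) - V 0 d) \<bullet> y = (V d (d + h) - V 0 h) \<bullet> y" for y
      proof -
        have "((\<lambda>s. S s x \<bullet> adjoint (S h) y) has_integral V 0 d \<bullet> adjoint (S h) y) {0..d}" by (rule V) simp
        then have "((\<lambda>s. S h (S s x) \<bullet> y) has_integral S h (V 0 d) \<bullet> y) {0..d}"
          using h by (simp add: inner_adjoint[OF lin])
        moreover have "S h (S s x) \<bullet> y = S (s + h) x \<bullet> y" if "s \<in> {0..d}" for s
          using C0_semigroup_add[OF S, of h s x] h that by (simp add: add.commute)
        ultimately have "((\<lambda>s. S (s + h) x \<bullet> y) has_integral S h (V 0 d) \<bullet> y) {0..d}"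
          by (rule has_integral_eq[rotated])
        then have "((\<lambda>s. S s x \<bullet> y) has_integral S h (V 0 d) \<bullet> y) {h..d + h}"
          using has_integral_shift_real_ivl[of "\<lambda>s. S (s + h) x \<bullet> y" "S h (V 0 d) \<bullet> y" 0 d "- h"] by simp
        then have "((\<lambda>s. S s x \<bullet> y) has_integral V 0 h \<bullet> y + S h (V 0 d) \<bullet> y) {0..d + h}"
          using h d by (intro has_integral_combine[OF _ _ V]) auto
        moreover have "((\<lambda>s. S s x \<bullet> y) has_integral V 0 d \<bullet> y + V d (d + h) \<bullet> y) {0..d + h}"
          using h d by (intro has_integral_combine[OF _ _ V V]) auto
        ultimately have "V 0 h \<bullet> y + S h (V 0 d) \<bullet> y = V 0 d \<bullet> y + V d (d + h) \<bullet> y"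
          by (rule has_integral_unique)
        then show ?thesis by (simp add: inner_diff_left)
      qed
      then show ?thesis using vector_eq_rdot by blast
    qed
    have "((\<lambda>h. (1 / h) *\<^sub>R V d (d + h) - (1 / h) *\<^sub>R V 0 (0 + h)) \<longlongrightarrow> S d x - S 0 x) (at_right 0)"
      using d by (intro tendsto_diff avg) auto
    then have "((\<lambda>h. (1 / h) *\<^sub>R (S h (V 0 d) - V 0 d)) \<longlongrightarrow> S d x - S 0 x) (at_right 0)"
      by (rule Lim_transform_eventually)
         (auto simp: eventually_at_right_field eq scaleR_diff_right[symmetric] intro!: exI[of _ 1])
    then show ?thesis by (auto simp: generator_def)
  qed
  have scale: "r *\<^sub>R u \<in> Domain (generator S)" if u: "u \<in> Domain (generator S)" for r u
  proof -
    obtain u' where "((\<lambda>t. (1 / t) *\<^sub>R (S t u - u)) \<longlongrightarrow> u') (at_right 0)"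
      using u by (auto simp: generator_def)
    then have "((\<lambda>t. r *\<^sub>R ((1 / t) *\<^sub>R (S t u - u))) \<longlongrightarrow> r *\<^sub>R u') (at_right 0)"
      by (intro tendsto_intros)
    then have "((\<lambda>t. (1 / t) *\<^sub>R (S t (r *\<^sub>R u) - r *\<^sub>R u)) \<longlongrightarrow> r *\<^sub>R u') (at_right 0)"
    proof (rule Lim_transform_eventually)
      show "\<forall>\<^sub>F t in at_right 0. r *\<^sub>R (1 / t) *\<^sub>R (S t u - u) = (1 / t) *\<^sub>R (S t (r *\<^sub>R u) - r *\<^sub>R u)"
        unfolding eventually_at_right_field
        by (intro exI[of _ 1]) (simp add: linear_simps[OF lin] scaleR_diff_right mult.commute)
    qed
    then show ?thesis by (auto simp: generator_def)
  qed
  show thesis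
  proof (rule that)
    show "(1 / (1 / Suc n)) *\<^sub>R V 0 (0 + 1 / Suc n) \<in> Domain (generator S)" for n
      by (intro scale) (simp add: dom)
    have "filterlim (\<lambda>n. 1 / real (Suc n)) (at_right 0) sequentially"
      unfolding filterlim_at using LIMSEQ_inverse_real_of_nat by (auto simp: inverse_eq_divide)
    from filterlim_compose[OF avg[of 0] this]
    show "(\<lambda>n. (1 / (1 / real (Suc n))) *\<^sub>R V 0 (0 + 1 / Suc n)) \<longlonglongrightarrow> x"
      using S by (simp add: C0_semigroup_def)
  qed
qed

text \<open>
  For every slope \<open>e > 0\<close>, let \<open>s\<close> be the last time at which \<open>norm (\<phi> s - \<phi> 0) \<le> e * s\<close>.  The right
  derivative at \<open>s\<close> lets this inequality persist a little longer unless \<open>s = t\<close>.  Right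
  derivatives are what the definition of a generator provides.
\<close>

lemma constant_if_right_derivative_0:
  fixes \<phi> :: "real \<Rightarrow> 'a::real_normed_vector"
  assumes t: "0 \<le> t" and cont: "continuous_on {0..t} \<phi>"
    and der: "\<And>s. 0 \<le> s \<Longrightarrow> s < t \<Longrightarrow> ((\<lambda>h. (1 / h) *\<^sub>R (\<phi> (s + h) - \<phi> s)) \<longlongrightarrow> 0) (at_right 0)"
  shows "\<phi> t = \<phi> 0"
proof -
  have "norm (\<phi> t - \<phi> 0) \<le> e * t" if e: "0 < e" for e
  proof (rule ccontr)
    assume neg: "\<not> ?thesis"
    define C where "C = {s\<in>{0..t}. norm (\<phi> s - \<phi> 0) \<le> e * s}"
    have "closed C" unfolding C_def
      by (intro continuous_on_closed_Collect_le continuous_intros cont)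
    then have "compact C" using compact_Int_closed[OF compact_Icc, of C 0 t]
      by (simp add: C_def Int_absorb1 subset_iff)
    moreover have "0 \<in> C" using t by (simp add: C_def)
    ultimately obtain s where s: "s \<in> C" "\<And>r. r \<in> C \<Longrightarrow> r \<le> s"
      using compact_attains_sup[of C] by blast
    have st: "0 \<le> s" "s < t" using s(1) neg by (auto simp: C_def order_less_le)
    from tendstoD[OF der[OF st] e] obtain d where d: "0 < d"
      and dd: "\<And>h. 0 < h \<Longrightarrow> h < d \<Longrightarrow> norm ((1 / h) *\<^sub>R (\<phi> (s + h) - \<phi> s)) < e"
      unfolding eventually_at_right_field by (auto simp: dist_norm)
    define h where "h = min d (t - s) / 2"
    have h: "0 < h" "h < d" "s + h \<le> t" using d st by (auto simp: h_def min_def field_simps)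
    have "norm (\<phi> (s + h) - \<phi> s) / h < e" using dd[OF h(1,2)] h(1) by simp
    then have "norm (\<phi> (s + h) - \<phi> s) \<le> e * h" using h(1) by (simp add: pos_divide_less_eq less_imp_le)
    then have "norm (\<phi> (s + h) - \<phi> 0) \<le> e * (s + h)"
      using s(1) norm_triangle_ineq[of "\<phi> (s + h) - \<phi> s" "\<phi> s - \<phi> 0"] by (simp add: C_def algebra_simps)
    then have "s + h \<in> C" using st h by (simp add: C_def)
    then show False using s(2) h by fastforce
  qed
  note * = this
  have "norm (\<phi> t - \<phi> 0) \<le> 0"
  proof (rule field_le_epsilon)
    fix e :: real assume e: "0 < e"
    have "e / (t + 1) * t \<le> e" using t e by (simp add: field_simps)
    then show "norm (\<phi> t - \<phi> 0) \<le> 0 + e" using *[of "e / (t + 1)"] e t by simp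
  qed
  then show ?thesis by simp
qed

text \<open>
  For \<open>x\<close> in the common domain, \<open>s \<mapsto> S (t - s) (S' s x)\<close> interpolates between \<open>S t x\<close> and \<open>S' t x\<close>.
  Its right difference quotient at \<open>s\<close> compares the difference quotients of \<open>S\<close> and \<open>S'\<close> at the point
  \<open>S' s x\<close>, which lies in the domain again; both tend to the value of the generator there.
\<close>

lemma semigroup_unique:
  fixes S S' :: "real \<Rightarrow> 'a \<Rightarrow> 'a::{real_inner, complete_space}"
  assumes S: "C0_semigroup S" and S': "C0_semigroup S'" and gen: "generator S = generator S'"
    and t: "0 \<le> t"
  shows "S t x = S' t x"
proof -
  have lin: "bounded_linear (S t)" "bounded_linear (S' t)" if "0 \<le> t" for t
    using S S' that by (auto simp: C0_semigroup_def)
  obtain M where M: "0 < M" "\<And>r x. 0 \<le> r \<Longrightarrow> r \<le> t \<Longrightarrow> norm (S r x) \<le> M * norm x"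
    using C0_semigroup_bounded[OF S, of t] by blast
  have on_domain: "S t x = S' t x" if x: "x \<in> Domain (generator S')" for x
  proof -
    define \<phi> where "\<phi> s = S (t - s) (S' s x)" for s
    have "\<phi> t = \<phi> 0"
    proof (rule constant_if_right_derivative_0[OF t])
      have c1: "continuous_on {0..t} (\<lambda>s. S (t - s) y)" for y
        by (rule continuous_on_compose2[OF C0_semigroup_orbit_continuous[OF S, of t]])
           (auto intro!: continuous_intros)
      have c2: "continuous_on {0..t} (\<lambda>s. S' s x)" by (rule C0_semigroup_orbit_continuous[OF S'])
      show "continuous_on {0..t} \<phi>"
        unfolding continuous_on_def
      proof
        fix r assume r: "r \<in> {0..t}"
        \<comment> \<open>The inner argument converges uniformly in the outer time, by the bound \<open>M\<close>.\<close>
        have "((\<lambda>s. S (t - s) (S' s x - S' r x)) \<longlongrightarrow> 0) (at r within {0..t})"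
        proof (rule Lim_null_comparison)
          show "\<forall>\<^sub>F s in at r within {0..t}. norm (S (t - s) (S' s x - S' r x)) \<le> M * norm (S' s x - S' r x)"
            unfolding eventually_at by (intro exI[of _ 1]) (auto intro!: M(2))
          have "((\<lambda>s. S' s x - S' r x) \<longlongrightarrow> 0) (at r within {0..t})"
            using c2 r by (simp add: continuous_on_def LIM_zero)
          then show "((\<lambda>s. M * norm (S' s x - S' r x)) \<longlongrightarrow> 0) (at r within {0..t})"
            using tendsto_mult_right_zero tendsto_norm_zero by blast
        qed
        then have "((\<lambda>s. S (t - s) (S' s x - S' r x) + S (t - s) (S' r x)) \<longlongrightarrow> 0 + \<phi> r) (at r within {0..t})"
          using c1[of "S' r x"] r by (intro tendsto_add) (auto simp: continuous_on_def \<phi>_def)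
        then have "((\<lambda>s. S (t - s) (S' s x - S' r x) + S (t - s) (S' r x)) \<longlongrightarrow> \<phi> r) (at r within {0..t})"
          by simp
        then show "(\<phi> \<longlongrightarrow> \<phi> r) (at r within {0..t})"
          by (rule Lim_transform_eventually)
             (auto simp: eventually_at \<phi>_def linear_simps[OF lin(1)] intro!: exI[of _ 1])
      qed
    next
      fix s assume s: "0 \<le> s" "s < t"
      define y where "y = S' s x"
      obtain x' where x': "((\<lambda>h. (1 / h) *\<^sub>R (S' h x - x)) \<longlongrightarrow> x') (at_right 0)"
        using x by (auto simp: generator_def)
      have S'y: "((\<lambda>h. (1 / h) *\<^sub>R (S' h y - y)) \<longlongrightarrow> S' s x') (at_right 0)"
      proof (rule Lim_transform_eventually)
        show "((\<lambda>h. S' s ((1 / h) *\<^sub>R (S' h x - x))) \<longlongrightarrow> S' s x') (at_right 0)"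
          by (rule bounded_linear.tendsto[OF lin(2)[OF s(1)] x'])
        have "S' s (S' h x) = S' h y" if "0 < h" for h
          using C0_semigroup_add[OF S', of s h x] C0_semigroup_add[OF S', of h s x] s that
          by (simp add: y_def add.commute)
        then show "\<forall>\<^sub>F h in at_right 0. S' s ((1 / h) *\<^sub>R (S' h x - x)) = (1 / h) *\<^sub>R (S' h y - y)"
          unfolding eventually_at_right_field
          by (intro exI[of _ 1]) (simp add: linear_simps[OF lin(2)[OF s(1)]] y_def)
      qed
      then have "(y, S' s x') \<in> generator S" unfolding gen by (simp add: generator_def)
      then have Sy: "((\<lambda>h. (1 / h) *\<^sub>R (S h y - y)) \<longlongrightarrow> S' s x') (at_right 0)"
        by (simp add: generator_def)
      show "((\<lambda>h. (1 / h) *\<^sub>R (\<phi> (s + h) - \<phi> s)) \<longlongrightarrow> 0) (at_right 0)"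
      proof (rule Lim_null_comparison)
        show "((\<lambda>h. M * norm ((1 / h) *\<^sub>R (S' h y - y) - (1 / h) *\<^sub>R (S h y - y))) \<longlongrightarrow> 0) (at_right 0)"
          using tendsto_mult_right_zero[OF tendsto_norm_zero] tendsto_diff[OF S'y Sy] by simp
        have "norm ((1 / h) *\<^sub>R (\<phi> (s + h) - \<phi> s))
            \<le> M * norm ((1 / h) *\<^sub>R (S' h y - y) - (1 / h) *\<^sub>R (S h y - y))" if h: "0 < h" "h < t - s" for h
        proof -
          have "S' (s + h) x = S' h y" "S (t - s) y = S (t - (s + h)) (S h y)"
            using C0_semigroup_add[OF S', of h s x] C0_semigroup_add[OF S, of "t - (s + h)" h y] s h
            by (simp_all add: y_def add.commute)
          then have "(1 / h) *\<^sub>R (\<phi> (s + h) - \<phi> s)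
              = S (t - (s + h)) ((1 / h) *\<^sub>R (S' h y - y) - (1 / h) *\<^sub>R (S h y - y))"
            using s h by (simp add: \<phi>_def y_def[symmetric] linear_simps[OF lin(1)] scaleR_diff_right)
          also have "norm \<dots> \<le> M * norm ((1 / h) *\<^sub>R (S' h y - y) - (1 / h) *\<^sub>R (S h y - y))"
            using s h by (intro M(2)) auto
          finally show ?thesis .
        qed
        then show "\<forall>\<^sub>F h in at_right 0. norm ((1 / h) *\<^sub>R (\<phi> (s + h) - \<phi> s))
            \<le> M * norm ((1 / h) *\<^sub>R (S' h y - y) - (1 / h) *\<^sub>R (S h y - y))"
          unfolding eventually_at_right_field using s by (intro exI[of _ "t - s"]) auto
      qed
    qed
    then show ?thesis using S S' by (simp add: \<phi>_def C0_semigroup_def)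
  qed
  obtain X where X: "\<And>n::nat. X n \<in> Domain (generator S')" "X \<longlonglongrightarrow> x"
    using generator_domain_dense[OF S', of x] by blast
  have "(\<lambda>n. S t (X n)) \<longlonglongrightarrow> S t x" "(\<lambda>n. S' t (X n)) \<longlonglongrightarrow> S' t x"
    using bounded_linear.tendsto[OF lin(1)[OF t] X(2)] bounded_linear.tendsto[OF lin(2)[OF t] X(2)] by auto
  then show ?thesis using on_domain[OF X(1)] by (simp add: LIMSEQ_unique)
qed

section \<open>The seminormed space \<open>L\<^sup>2\<close>\<close>

lemma strongly_measurable_add:
  assumes "strongly_measurable M f" "strongly_measurable M g"
  shows "strongly_measurable M (\<lambda>t. f t + g t)"
proof -
  obtain s where s: "\<And>n::nat. simple_function M (s n)" "AE x in M. (\<lambda>n. s n x) \<longlonglongrightarrow> f x"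
    using assms(1) unfolding strongly_measurable_def by blast
  obtain r where r: "\<And>n::nat. simple_function M (r n)" "AE x in M. (\<lambda>n. r n x) \<longlonglongrightarrow> g x"
    using assms(2) unfolding strongly_measurable_def by blast
  have "simple_function M (\<lambda>x. s n x + r n x)" for n
    using simple_function_compose2[OF s(1) r(1), of "(+)"] .
  moreover have "AE x in M. (\<lambda>n. s n x + r n x) \<longlonglongrightarrow> f x + g x"
    using s(2) r(2) by eventually_elim (rule tendsto_add)
  ultimately show ?thesis unfolding strongly_measurable_def by (intro exI[of _ "\<lambda>n x. s n x + r n x"]) auto
qed

lemma strongly_measurable_scaleR:
  assumes "strongly_measurable M f"
  shows "strongly_measurable M (\<lambda>t. c *\<^sub>R f t)"
proof -
  obtain s where s: "\<And>n::nat. simple_function M (s n)" "AE x in M. (\<lambda>n. s n x) \<longlonglongrightarrow> f x"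
    using assms unfolding strongly_measurable_def by blast
  have "simple_function M (\<lambda>x. c *\<^sub>R s n x)" for n
    using simple_function_compose1[OF s(1), of "scaleR c"] .
  moreover have "AE x in M. (\<lambda>n. c *\<^sub>R s n x) \<longlonglongrightarrow> c *\<^sub>R f x"
    using s(2) by eventually_elim (intro tendsto_intros)
  ultimately show ?thesis unfolding strongly_measurable_def by (intro exI[of _ "\<lambda>n x. c *\<^sub>R s n x"]) auto
qed

text \<open>
  Simple functions approximate \<open>f\<close> only outside a null set; completeness of Lebesgue measure makes
  the exceptional set harmless.
\<close>

lemma borel_measurable_norm_lebesgue:
  assumes f: "strongly_measurable (lebesgue_on S) f" and S: "S \<in> sets lebesgue"
  shows "(\<lambda>t. norm (f t)) \<in> borel_measurable (lebesgue_on S)"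
proof -
  obtain s where s: "\<And>n::nat. simple_function (lebesgue_on S) (s n)"
    "AE x in lebesgue_on S. (\<lambda>n. s n x) \<longlonglongrightarrow> f x"
    using f unfolding strongly_measurable_def by blast
  obtain N where N: "\<And>x. x \<in> space (lebesgue_on S) - N \<Longrightarrow> (\<lambda>n. s n x) \<longlonglongrightarrow> f x"
    "N \<in> null_sets (lebesgue_on S)"
    using AE_E3[OF s(2)] by blast
  have "(\<lambda>x. indicat_real (- N) x * norm (f x)) \<in> borel_measurable (lebesgue_on S)"
  proof (rule borel_measurable_LIMSEQ_real)
    show "(\<lambda>n. indicat_real (- N) x * norm (s n x)) \<longlonglongrightarrow> indicat_real (- N) x * norm (f x)"
      if "x \<in> space (lebesgue_on S)" for x
      using N(1) that by (cases "x \<in> N") (auto intro!: tendsto_intros)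
    have "(\<lambda>x. norm (s n x)) \<in> borel_measurable (lebesgue_on S)" for n
      using simple_function_compose1[OF s(1)] by (rule borel_measurable_simple_function)
    moreover have "N \<in> sets (lebesgue_on S)" using N(2) by auto
    ultimately show "(\<lambda>x. indicat_real (- N) x * norm (s n x)) \<in> borel_measurable (lebesgue_on S)" for n
      by (simp add: indicator_compl)
  qed
  then have "(\<lambda>x. if x \<in> S then indicat_real (- N) x * norm (f x) else 0) \<in> borel_measurable lebesgue"
    using S by (simp add: borel_measurable_if)
  moreover have "AE x in lebesgue. (if x \<in> S then indicat_real (- N) x * norm (f x) else 0)
      = (if x \<in> S then norm (f x) else 0)"
    using AE_not_in[OF N(2)] S by (simp add: AE_restrict_space_iff) (auto elim!: eventually_mono)
  ultimately have "(\<lambda>x. if x \<in> S then norm (f x) else 0) \<in> borel_measurable lebesgue"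
    by (rule borel_measurable_AE)
  then show ?thesis using S by (simp add: borel_measurable_if)
qed

lemma square_sum_le:
  fixes x y r :: real
  assumes r: "0 < r"
  shows "(x + y)\<^sup>2 \<le> (1 + r) * x\<^sup>2 + (1 + 1 / r) * y\<^sup>2"
proof -
  have "0 \<le> (r * x - y)\<^sup>2 / r" using r by simp
  also have "(r * x - y)\<^sup>2 / r = r * x\<^sup>2 - 2 * x * y + (1 / r) * y\<^sup>2"
    using r by (simp add: power2_diff diff_divide_distrib add_divide_distrib power_mult_distrib power2_eq_square[of r])
  finally show ?thesis by (simp add: power2_sum distrib_right)
qed

lemma L2_add:
  assumes f: "f \<in> L2 T" and g: "g \<in> L2 T"
  shows "(\<lambda>t. f t + g t) \<in> L2 T"
proof -
  have m: "strongly_measurable (time_measure T) (\<lambda>t. f t + g t)"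
    using f g by (auto simp: L2_def intro: strongly_measurable_add)
  have "integrable (time_measure T) (\<lambda>t. (norm (f t + g t))\<^sup>2)"
  proof (rule Bochner_Integration.integrable_bound)
    show "integrable (time_measure T) (\<lambda>t. 2 * (norm (f t))\<^sup>2 + 2 * (norm (g t))\<^sup>2)"
      using f g by (simp add: L2_def)
    show "(\<lambda>t. (norm (f t + g t))\<^sup>2) \<in> borel_measurable (time_measure T)"
      using borel_measurable_norm_lebesgue[OF m] by (intro borel_measurable_power) auto
    have "(norm (f t + g t))\<^sup>2 \<le> 2 * (norm (f t))\<^sup>2 + 2 * (norm (g t))\<^sup>2" for t
      using order_trans[OF power_mono[OF norm_triangle_ineq] square_sum_le[of 1], of "f t" "g t"] by simp
    then show "AE t in time_measure T. norm ((norm (f t + g t))\<^sup>2) \<le> norm (2 * (norm (f t))\<^sup>2 + 2 * (norm (g t))\<^sup>2)"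
      by simp
  qed
  then show ?thesis using m by (simp add: L2_def)
qed

lemma L2_scaleR: "f \<in> L2 T \<Longrightarrow> (\<lambda>t. c *\<^sub>R f t) \<in> L2 T"
  by (auto simp: L2_def power_mult_distrib intro: strongly_measurable_scaleR)

lemma L2_diff:
  assumes "f \<in> L2 T" "g \<in> L2 T"
  shows "(\<lambda>t. f t - g t) \<in> L2 T"
proof -
  have "(\<lambda>t. f t + (- 1) *\<^sub>R g t) \<in> L2 T" by (intro L2_add L2_scaleR assms)
  then show ?thesis by simp
qed

lemma L2_norm_nonneg: "0 \<le> L2_norm T f"
  by (simp add: L2_norm_def)

lemma L2_norm_power2: "(L2_norm T f)\<^sup>2 = (\<integral>t. (norm (f t))\<^sup>2 \<partial>time_measure T)"
  by (simp add: L2_norm_def)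

lemma L2_norm_scaleR: "L2_norm T (\<lambda>t. c *\<^sub>R f t) = \<bar>c\<bar> * L2_norm T f"
  by (simp add: L2_norm_def power_mult_distrib real_sqrt_mult)

text \<open>
  Minkowski's inequality, from the weighted inequality \<open>square_sum_le\<close> with the weight \<open>r = b / a\<close>,
  for which its right-hand side integrates to \<open>(a + b)\<^sup>2\<close>.  The norms \<open>a\<close> and \<open>b\<close> may vanish and are
  therefore increased by \<open>e\<close> first.
\<close>

lemma L2_norm_triangle:
  assumes f: "f \<in> L2 T" and g: "g \<in> L2 T"
  shows "L2_norm T (\<lambda>t. f t + g t) \<le> L2_norm T f + L2_norm T g"
proof -
  define a where "a = L2_norm T f"
  define b where "b = L2_norm T g"
  have nn: "0 \<le> a" "0 \<le> b" by (simp_all add: a_def b_def L2_norm_nonneg)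
  have int: "integrable (time_measure T) (\<lambda>t. (norm (f t))\<^sup>2)" "integrable (time_measure T) (\<lambda>t. (norm (g t))\<^sup>2)"
    using f g by (simp_all add: L2_def)
  have young: "(L2_norm T (\<lambda>t. f t + g t))\<^sup>2 \<le> (1 + r) * a\<^sup>2 + (1 + 1 / r) * b\<^sup>2" if r: "0 < r" for r
  proof -
    have "(norm (f t + g t))\<^sup>2 \<le> (1 + r) * (norm (f t))\<^sup>2 + (1 + 1 / r) * (norm (g t))\<^sup>2" for t
      by (rule order_trans[OF power_mono[OF norm_triangle_ineq] square_sum_le[OF r]]) simp
    then have "(L2_norm T (\<lambda>t. f t + g t))\<^sup>2
        \<le> (\<integral>t. (1 + r) * (norm (f t))\<^sup>2 + (1 + 1 / r) * (norm (g t))\<^sup>2 \<partial>time_measure T)"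
      unfolding L2_norm_power2 using L2_add[OF f g] int by (intro integral_mono) (auto simp: L2_def)
    also have "\<dots> = (1 + r) * a\<^sup>2 + (1 + 1 / r) * b\<^sup>2"
      unfolding a_def b_def L2_norm_power2 using int by simp
    finally show ?thesis .
  qed
  have "(L2_norm T (\<lambda>t. f t + g t))\<^sup>2 \<le> (a + b + 2 * e)\<^sup>2" if e: "0 < e" for e
  proof -
    \<comment> \<open>up to the shift by \<open>e\<close>, the weight that minimises the right-hand side of \<open>young\<close>\<close>
    define r where "r = (b + e) / (a + e)"
    have pos: "0 < a + e" "0 < b + e" using nn e by auto
    have r: "0 < r" using pos by (simp add: r_def)
    have "(L2_norm T (\<lambda>t. f t + g t))\<^sup>2 \<le> (1 + r) * a\<^sup>2 + (1 + 1 / r) * b\<^sup>2" by (rule young[OF r])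
    also have "\<dots> \<le> (1 + r) * (a + e)\<^sup>2 + (1 + 1 / r) * (b + e)\<^sup>2"
      using r nn e by (intro add_mono mult_left_mono power_mono) auto
    also have "\<dots> = (a + e)\<^sup>2 + r * (a + e)\<^sup>2 + (b + e)\<^sup>2 + (1 / r) * (b + e)\<^sup>2"
      by (simp add: distrib_right)
    also have "r * (a + e)\<^sup>2 = (a + e) * (b + e)" using pos by (simp add: r_def power2_eq_square)
    also have "(1 / r) * (b + e)\<^sup>2 = (a + e) * (b + e)" using pos by (simp add: r_def power2_eq_square)
    also have "(a + e)\<^sup>2 + (a + e) * (b + e) + (b + e)\<^sup>2 + (a + e) * (b + e) = (a + b + 2 * e)\<^sup>2"
      by (simp add: power2_eq_square algebra_simps)
    finally show ?thesis .
  qed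
  then have eps: "L2_norm T (\<lambda>t. f t + g t) \<le> a + b + 2 * e" if "0 < e" for e
    using power2_le_imp_le[of "L2_norm T (\<lambda>t. f t + g t)" "a + b + 2 * e"] that nn by simp
  have "L2_norm T (\<lambda>t. f t + g t) \<le> a + b"
  proof (rule field_le_epsilon)
    fix e :: real assume "0 < e"
    then show "L2_norm T (\<lambda>t. f t + g t) \<le> a + b + e" using eps[of "e / 2"] by simp
  qed
  then show ?thesis by (simp add: a_def b_def)
qed

lemma L2_norm_diff_triangle:
  assumes "f \<in> L2 T" "g \<in> L2 T"
  shows "L2_norm T (\<lambda>t. f t - g t) \<le> L2_norm T f + L2_norm T g"
proof -
  have "L2_norm T (\<lambda>t. f t + (- 1) *\<^sub>R g t) \<le> L2_norm T f + L2_norm T (\<lambda>t. (- 1) *\<^sub>R g t)"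
    by (intro L2_norm_triangle L2_scaleR assms)
  also have "L2_norm T (\<lambda>t. (- 1) *\<^sub>R g t) = L2_norm T g" unfolding L2_norm_scaleR by simp
  finally show ?thesis by simp
qed

text \<open>
  Simple approximations are obtained by sampling \<open>f\<close> at the points of finer and finer grids.
\<close>

lemma continuous_imp_L2:
  fixes f :: "real \<Rightarrow> 'a::real_normed_vector"
  assumes T: "0 < T" and cont: "continuous_on {0..T} f"
  shows "f \<in> L2 T"
proof -
  \<comment> \<open>\<open>\<delta> n t\<close> is the left end point of the cell of length \<open>T / Suc n\<close> that contains \<open>t\<close>.\<close>
  define \<delta> where "\<delta> n t = of_int \<lfloor>t / (T / Suc n)\<rfloor> * (T / Suc n)" for n :: nat and t :: real
  have cell: "0 < T / Suc n" for n using T by simp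
  have \<delta>: "\<delta> n t \<le> t" "t < \<delta> n t + T / Suc n" for n t
    using floor_divide_lower[OF cell, of t n] floor_divide_upper[OF cell, of t n]
    unfolding \<delta>_def distrib_right mult_1_left .
  have \<delta>0: "0 \<le> \<delta> n t" if "0 \<le> t" for n t using that T by (simp add: \<delta>_def)
  have simple: "simple_function (time_measure T) (\<delta> n)" for n
  proof -
    have "\<delta> n ` {0<..<T} \<subseteq> (\<lambda>k. of_int k * (T / Suc n)) ` {0..int (Suc n)}"
    proof (rule image_subsetI)
      fix t assume t: "t \<in> {0<..<T}"
      have "t / (T / Suc n) \<le> T / (T / Suc n)"
        using t cell[of n] by (intro divide_right_mono) auto
      then have "t / (T / Suc n) \<le> of_int (int (Suc n))" using T by simp
      then have "\<lfloor>t / (T / Suc n)\<rfloor> \<le> int (Suc n)" by (simp only: floor_le_iff)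
      moreover have "0 \<le> \<lfloor>t / (T / Suc n)\<rfloor>" using t by simp
      ultimately show "\<delta> n t \<in> (\<lambda>k. of_int k * (T / real (Suc n))) ` {0..int (Suc n)}"
        unfolding \<delta>_def by (intro image_eqI[of _ _ "\<lfloor>t / (T / Suc n)\<rfloor>"]) auto
    qed
    then have "finite (\<delta> n ` {0<..<T})" by (rule finite_subset) auto
    moreover have "\<delta> n \<in> borel_measurable (time_measure T)"
    proof -
      have "(\<lambda>t. t) \<in> borel_measurable (time_measure T)"
        by (intro continuous_imp_measurable_on_sets_lebesgue) auto
      moreover have "\<delta> n \<in> borel_measurable borel" unfolding \<delta>_def by measurable
      ultimately show ?thesis using measurable_compose by blast
    qed
    ultimately show ?thesis by (simp add: simple_function_borel_measurable)
  qed
  have "(\<lambda>n. f (\<delta> n t)) \<longlonglongrightarrow> f t" if t: "t \<in> {0<..<T}" for t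
  proof (rule continuous_on_tendsto_compose[OF cont])
    show "(\<lambda>n. \<delta> n t) \<longlonglongrightarrow> t"
    proof (rule tendsto_sandwich[where f="\<lambda>n. t - T / Suc n" and h="\<lambda>_. t"])
      have "(\<lambda>n. t - T * inverse (real (Suc n))) \<longlonglongrightarrow> t - T * 0"
        by (intro tendsto_intros LIMSEQ_inverse_real_of_nat)
      then show "(\<lambda>n. t - T / Suc n) \<longlonglongrightarrow> t" by (simp add: divide_inverse)
      show "\<forall>\<^sub>F n in sequentially. t - T / real (Suc n) \<le> \<delta> n t"
        using \<delta>(2) by (intro always_eventually allI) (smt (verit))
    qed (use \<delta>(1) in auto)
    show "\<forall>\<^sub>F n in sequentially. \<delta> n t \<in> {0..T}"
      using \<delta>(1)[of _ t] \<delta>0[of t] t by (intro always_eventually allI) (smt (verit) atLeastAtMost_iff greaterThanLessThan_iff)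
  qed (use t in auto)
  then have sm: "strongly_measurable (time_measure T) f"
    unfolding strongly_measurable_def using simple_function_compose1[OF simple, of f]
    by (intro exI[of _ "\<lambda>n t. f (\<delta> n t)"]) (auto intro!: AE_I2)
  obtain K where K: "\<And>t. t \<in> {0..T} \<Longrightarrow> norm (f t) \<le> K"
    using compact_imp_bounded[OF compact_continuous_image[OF cont]] unfolding bounded_iff by fastforce
  interpret finite_measure "time_measure T" by (rule finite_measure_lebesgue_on) simp
  have "integrable (time_measure T) (\<lambda>t. (norm (f t))\<^sup>2)"
  proof (rule integrable_const_bound)
    show "AE t in time_measure T. norm ((norm (f t))\<^sup>2) \<le> K\<^sup>2"
      by (intro AE_I2) (auto intro!: power_mono K)
    show "(\<lambda>t. (norm (f t))\<^sup>2) \<in> borel_measurable (time_measure T)"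
      using borel_measurable_norm_lebesgue[OF sm] by (intro borel_measurable_power) auto
  qed
  then show ?thesis using sm by (simp add: L2_def)
qed

lemma L2_norm_le_bound:
  assumes T: "0 < T" and f: "f \<in> L2 T" and K: "0 \<le> K" "\<And>t. t \<in> {0<..<T} \<Longrightarrow> norm (f t) \<le> K"
  shows "L2_norm T f \<le> sqrt T * K"
proof -
  interpret finite_measure "time_measure T" by (rule finite_measure_lebesgue_on) simp
  have "(\<integral>t. (norm (f t))\<^sup>2 \<partial>time_measure T) \<le> (\<integral>t. K\<^sup>2 \<partial>time_measure T)"
    using f K by (intro integral_mono) (auto simp: L2_def intro!: power_mono)
  also have "\<dots> = T * K\<^sup>2" using T by (simp add: measure_restrict_space)
  finally have "L2_norm T f \<le> sqrt (T * K\<^sup>2)" unfolding L2_norm_def by simp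
  then show ?thesis using K by (simp add: real_sqrt_mult)
qed

lemma L2_restrict:
  assumes "\<tau> \<le> T" and f: "f \<in> L2 T"
  shows "f \<in> L2 \<tau>" "L2_norm \<tau> f \<le> L2_norm T f"
proof -
  have sub: "{0<..<\<tau>} \<subseteq> {0<..<T}" using assms by auto
  obtain s where s: "\<And>n::nat. simple_function (time_measure T) (s n)"
    "AE x in time_measure T. (\<lambda>n. s n x) \<longlonglongrightarrow> f x"
    using f unfolding L2_def strongly_measurable_def by auto
  have "simple_function (time_measure \<tau>) (s n)" for n
    unfolding simple_function_def
  proof (intro conjI ballI)
    show "finite (s n ` space (time_measure \<tau>))"
      using s(1)[of n] finite_subset[OF image_mono[OF sub], of "s n"] by (simp add: simple_function_def)
    fix x assume x: "x \<in> s n ` space (time_measure \<tau>)"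
    have "s n -` {x} \<inter> {0<..<T} \<in> sets (time_measure T)"
      using s(1)[of n] x sub by (auto simp: simple_function_def)
    then have "s n -` {x} \<inter> {0<..<T} \<in> sets lebesgue" by (simp add: sets_restrict_space_iff)
    then have "(s n -` {x} \<inter> {0<..<T}) \<inter> {0<..<\<tau>} \<in> sets lebesgue" by (rule sets.Int) simp
    moreover have "(s n -` {x} \<inter> {0<..<T}) \<inter> {0<..<\<tau>} = s n -` {x} \<inter> {0<..<\<tau>}" using sub by blast
    ultimately show "s n -` {x} \<inter> space (time_measure \<tau>) \<in> sets (time_measure \<tau>)"
      by (simp add: sets_restrict_space_iff)
  qed
  moreover have "AE x in time_measure \<tau>. (\<lambda>n. s n x) \<longlonglongrightarrow> f x"
    using s(2) sub by (auto simp: AE_restrict_space_iff elim!: eventually_mono)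
  ultimately have sm: "strongly_measurable (time_measure \<tau>) f" unfolding strongly_measurable_def by blast
  have i: "set_integrable lebesgue {0<..<T} (\<lambda>t. (norm (f t))\<^sup>2)"
    using f by (simp add: L2_def set_integrable_def integrable_restrict_space)
  then have i': "set_integrable lebesgue {0<..<\<tau>} (\<lambda>t. (norm (f t))\<^sup>2)"
    by (rule set_integrable_subset) (use sub in auto)
  then show "f \<in> L2 \<tau>" using sm by (simp add: L2_def set_integrable_def integrable_restrict_space)
  have "(LINT t:{0<..<\<tau>}|lebesgue. (norm (f t))\<^sup>2) \<le> (LINT t:{0<..<T}|lebesgue. (norm (f t))\<^sup>2)"
    using i i' sub unfolding set_integrable_def set_lebesgue_integral_def
    by (intro integral_mono) (auto simp: indicator_def)
  then show "L2_norm \<tau> f \<le> L2_norm T f"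
    by (simp add: L2_norm_def integral_restrict_space set_lebesgue_integral_def)
qed

lemma L2_norm_zero_imp_AE:
  assumes "f \<in> L2 T" "L2_norm T f = 0"
  shows "AE t in time_measure T. f t = 0"
  using assms integral_nonneg_eq_0_iff_AE[of "time_measure T" "\<lambda>t. (norm (f t))\<^sup>2"]
  by (simp add: L2_def L2_norm_def)

lemma AE_imp_L2_norm_zero:
  assumes "AE t in time_measure T. f t = 0"
  shows "L2_norm T f = 0"
  unfolding L2_norm_def using assms by (subst integral_eq_zero_AE) auto

text \<open>Cauchy--Schwarz against the constant function, in terms of the Henstock--Kurzweil integral.\<close>

lemma L2_norm_integral:
  assumes T: "0 < T" and f: "f \<in> L2 T" and ab: "0 \<le> a" "b \<le> T"
  shows "(\<lambda>t. norm (f t)) integrable_on {a..b}"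
    and "integral {a..b} (\<lambda>t. norm (f t)) \<le> sqrt T * L2_norm T f"
proof -
  interpret finite_measure "time_measure T" by (rule finite_measure_lebesgue_on) simp
  have sq: "integrable (time_measure T) (\<lambda>t. (norm (f t))\<^sup>2)" using f by (simp add: L2_def)
  have meas: "(\<lambda>t. norm (f t)) \<in> borel_measurable (time_measure T)"
    using f borel_measurable_norm_lebesgue[of "{0<..<T}" f] by (simp add: L2_def)
  have young: "norm (f t) \<le> (r + (norm (f t))\<^sup>2 / r) / 2" if "0 < r" for r t
    using sum_squares_bound[of r "norm (f t)"] that by (simp add: field_simps power2_eq_square)
  have int: "integrable (time_measure T) (\<lambda>t. norm (f t))"
  proof (rule Bochner_Integration.integrable_bound[OF _ meas])
    show "integrable (time_measure T) (\<lambda>t. (1 + (norm (f t))\<^sup>2 / 1) / 2)" using sq by simp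
    show "AE t in time_measure T. norm (norm (f t)) \<le> norm ((1 + (norm (f t))\<^sup>2 / 1) / 2)"
      using young[of 1] by simp
  qed
  have hk: "((\<lambda>t. norm (f t)) has_integral (\<integral>t. norm (f t) \<partial>time_measure T)) {0..T}"
    using has_integral_integral_lebesgue_on[OF int]
    by (simp add: has_integral_Icc_iff_Ioo)
  then show on: "(\<lambda>t. norm (f t)) integrable_on {a..b}"
    using integrable_subinterval_real[of "\<lambda>t. norm (f t)" 0 T a b] ab by (auto simp: integrable_on_def)
  define c where "c = L2_norm T f"
  have c: "0 \<le> c" by (simp add: c_def L2_norm_nonneg)
  have "integral {a..b} (\<lambda>t. norm (f t)) \<le> integral {0..T} (\<lambda>t. norm (f t))"
    using on hk ab by (intro integral_subset_le) (auto simp: integrable_on_def)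
  also have "\<dots> = (\<integral>t. norm (f t) \<partial>time_measure T)" using hk by (rule integral_unique)
  also have "\<dots> \<le> sqrt T * c"
  proof (rule field_le_epsilon)
    fix e :: real assume e: "0 < e"
    \<comment> \<open>For \<open>e = 0\<close> this weight turns the pointwise bound \<open>young\<close> into the Cauchy--Schwarz bound; \<open>e\<close> keeps it positive.\<close>
    define r where "r = c / sqrt T + e / T"
    have r: "0 < r" using c e T by (simp add: r_def add_nonneg_pos)
    have "(\<integral>t. norm (f t) \<partial>time_measure T) \<le> (\<integral>t. (r + (norm (f t))\<^sup>2 / r) / 2 \<partial>time_measure T)"
      using int sq young[OF r] by (intro integral_mono) auto
    also have "\<dots> = (r * T + c\<^sup>2 / r) / 2"
      using sq T by (simp add: c_def L2_norm_power2 measure_restrict_space)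
    also have "\<dots> \<le> (r * T + sqrt T * c) / 2"
    proof -
      have "c \<le> sqrt T * r" using e T by (simp add: r_def field_simps)
      then have "c * c \<le> c * (sqrt T * r)" using c by (rule mult_left_mono)
      then show ?thesis using r by (simp add: field_simps power2_eq_square)
    qed
    also have "r * T = sqrt T * c + e" using T by (simp add: r_def field_simps)
    also have "(sqrt T * c + e + sqrt T * c) / 2 \<le> sqrt T * c + e" using e by simp
    finally show "(\<integral>t. norm (f t) \<partial>time_measure T) \<le> sqrt T * c + e" .
  qed
  finally show "integral {a..b} (\<lambda>t. norm (f t)) \<le> sqrt T * L2_norm T f" by (simp add: c_def)
qed

section \<open>Henstock--Kurzweil integrals of Hilbert space valued functions\<close>

text \<open>
  Testing the integral against itself reduces the triangle inequality for integrals to the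
  monotonicity of real integrals.
\<close>

lemma has_integral_norm_le:
  fixes f :: "real \<Rightarrow> 'a::real_inner"
  assumes f: "(f has_integral v) S" and g: "g integrable_on S"
    and le: "\<And>t. t \<in> S \<Longrightarrow> norm (f t) \<le> g t"
  shows "norm v \<le> integral S g"
proof (cases "v = 0")
  case True
  have "0 \<le> integral S g"
    using le by (intro integral_nonneg[OF g]) (meson norm_ge_zero order_trans)
  then show ?thesis using True by simp
next
  case False
  have "((\<lambda>t. f t \<bullet> v) has_integral v \<bullet> v) S"
    using has_integral_linear[OF f bounded_linear_inner_left[of v]] by (simp add: o_def)
  moreover have "((\<lambda>t. g t * norm v) has_integral integral S g * norm v) S"
    using g by (intro has_integral_mult_left integrable_integral)
  moreover have "f t \<bullet> v \<le> g t * norm v" if "t \<in> S" for t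
    by (rule order_trans[OF norm_cauchy_schwarz mult_right_mono[OF le[OF that]]]) simp
  ultimately have "v \<bullet> v \<le> integral S g * norm v" by (rule has_integral_le)
  then have "norm v * norm v \<le> integral S g * norm v"
    by (simp add: power2_norm_eq_inner[symmetric] power2_eq_square)
  then show ?thesis using False by simp
qed

lemma has_integral_gauge:
  fixes f :: "real \<Rightarrow> 'a::real_normed_vector"
  assumes "(f has_integral y) {a..b}" "0 < e"
  shows "\<exists>d. gauge d \<and> (\<forall>p. p tagged_division_of {a..b} \<longrightarrow> d fine p \<longrightarrow>
    norm ((\<Sum>(x, k)\<in>p. measure lborel k *\<^sub>R f x) - y) < e)"
  using assms unfolding has_integral_real imp_conjL by blast

text \<open>
  A fine division of \<open>{a..c}\<close> is completed to one of \<open>{a..b}\<close> by a division of \<open>{c..b}\<close> that is fine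
  enough for its own Riemann sum to be close to \<open>j\<close>.
\<close>

lemma has_integral_subtract_right:
  fixes f :: "real \<Rightarrow> 'a::real_normed_vector"
  assumes c: "a \<le> c" "c \<le> b" and whole: "(f has_integral i) {a..b}" and right: "(f has_integral j) {c..b}"
  shows "(f has_integral (i - j)) {a..c}"
  unfolding has_integral_real
proof (intro allI impI)
  fix e :: real assume e: "0 < e"
  have half: "{a..b} \<inter> {x. x \<bullet> 1 \<le> c} = {a..c}" "{a..b} \<inter> {x. x \<bullet> 1 \<ge> c} = {c..b}"
    using c by auto
  have "0 < e / 2" "(1::real) \<in> Basis" using e by auto
  from has_integral_separate_sides[OF whole[folded box_real(2)] this, of c]
  obtain d where d: "gauge d"
    and dd0: "\<forall>p q. p tagged_division_of (cbox a b \<inter> {x. x \<bullet> 1 \<le> c}) \<and> d fine p \<and>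
        q tagged_division_of (cbox a b \<inter> {x. x \<bullet> 1 \<ge> c}) \<and> d fine q \<longrightarrow>
        norm (((\<Sum>(x, k)\<in>p. measure lborel k *\<^sub>R f x) + (\<Sum>(x, k)\<in>q. measure lborel k *\<^sub>R f x)) - i) < e / 2"
    by metis
  have dd: "norm (((\<Sum>(x, k)\<in>p. measure lborel k *\<^sub>R f x) + (\<Sum>(x, k)\<in>q. measure lborel k *\<^sub>R f x)) - i) < e / 2"
    if "p tagged_division_of {a..c}" "d fine p" "q tagged_division_of {c..b}" "d fine q" for p q
    using dd0[unfolded box_real half] that by simp
  obtain d' where d': "gauge d'"
    and dd': "\<And>q. q tagged_division_of {c..b} \<Longrightarrow> d' fine q \<Longrightarrow> norm ((\<Sum>(x, k)\<in>q. measure lborel k *\<^sub>R f x) - j) < e / 2"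
    using has_integral_gauge[OF right, of "e / 2"] e by auto
  obtain q where q: "q tagged_division_of {c..b}" "(\<lambda>x. d x \<inter> d' x) fine q"
    using fine_division_exists_real[OF gauge_Int[OF d d']] by blast
  have "norm ((\<Sum>(x, k)\<in>p. measure lborel k *\<^sub>R f x) - (i - j)) < e"
    if p: "p tagged_division_of {a..c}" "d fine p" for p
  proof -
    define P where "P = (\<Sum>(x, k)\<in>p. measure lborel k *\<^sub>R f x)"
    define Q where "Q = (\<Sum>(x, k)\<in>q. measure lborel k *\<^sub>R f x)"
    have "norm (P + Q - i) < e / 2" "norm (Q - j) < e / 2"
      using dd[OF p q(1)] dd'[OF q(1)] q(2) by (auto simp: P_def Q_def fine_Int)
    then have "norm ((P + Q - i) - (Q - j)) < e"
      using norm_triangle_ineq4[of "P + Q - i" "Q - j"] by linarith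
    then have "norm (P - (i - j)) < e" by (simp add: algebra_simps)
    then show ?thesis by (simp add: P_def)
  qed
  then show "\<exists>\<gamma>. gauge \<gamma> \<and> (\<forall>\<D>. \<D> tagged_division_of {a..c} \<and> \<gamma> fine \<D> \<longrightarrow>
      norm ((\<Sum>(x, k)\<in>\<D>. measure lborel k *\<^sub>R f x) - (i - j)) < e)"
    using d by blast
qed

text \<open>
  Along a division fine for both \<open>F n\<close> and \<open>g n\<close>, the Riemann sums of \<open>f\<close> and \<open>F n\<close> differ by at most
  the Riemann sum of \<open>g n\<close>, which is close to \<open>J n\<close>.  In this way the limit is integrable as well.
\<close>

lemma has_integral_L1_limit:
  fixes f :: "real \<Rightarrow> 'a::real_normed_vector"
  assumes f: "\<And>n::nat. (F n has_integral I n) {a..b}" and I: "I \<longlonglongrightarrow> i"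
    and g: "\<And>n. (g n has_integral J n) {a..b}" and J: "J \<longlonglongrightarrow> 0"
    and le: "\<And>n t. t \<in> {a..b} \<Longrightarrow> norm (F n t - f t) \<le> g n t"
  shows "(f has_integral i) {a..b}"
  unfolding has_integral_real
proof (intro allI impI)
  fix e :: real assume e: "0 < e"
  have "\<forall>\<^sub>F n in sequentially. dist (I n) i < e / 4 \<and> dist (J n) 0 < e / 4"
    using e by (intro eventually_conj tendstoD[OF I] tendstoD[OF J]) auto
  then obtain n where n: "norm (I n - i) < e / 4" "\<bar>J n\<bar> < e / 4"
    unfolding eventually_sequentially by (auto simp: dist_norm)
  obtain d where d: "gauge d" and dd: "\<And>p. p tagged_division_of {a..b} \<Longrightarrow> d fine p \<Longrightarrow>
      norm ((\<Sum>(x, k)\<in>p. measure lborel k *\<^sub>R F n x) - I n) < e / 4"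
    using has_integral_gauge[OF f, of "e / 4" n] e by auto
  obtain d' where d': "gauge d'" and dd': "\<And>p. p tagged_division_of {a..b} \<Longrightarrow> d' fine p \<Longrightarrow>
      norm ((\<Sum>(x, k)\<in>p. measure lborel k *\<^sub>R g n x) - J n) < e / 4"
    using has_integral_gauge[OF g, of "e / 4" n] e by auto
  have "norm ((\<Sum>(x, k)\<in>p. measure lborel k *\<^sub>R f x) - i) < e"
    if p: "p tagged_division_of {a..b}" "(\<lambda>x. d x \<inter> d' x) fine p" for p
  proof -
    define P where "P = (\<Sum>(x, k)\<in>p. measure lborel k *\<^sub>R f x)"
    define Q where "Q = (\<Sum>(x, k)\<in>p. measure lborel k *\<^sub>R F n x)"
    define R where "R = (\<Sum>(x, k)\<in>p. measure lborel k *\<^sub>R g n x)"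
    have "norm (Q - P) = norm (\<Sum>(x, k)\<in>p. measure lborel k *\<^sub>R (F n x - f x))"
      by (simp add: P_def Q_def sum_subtractf[symmetric] scaleR_diff_right split_def)
    also have "\<dots> \<le> (\<Sum>(x, k)\<in>p. norm (measure lborel k *\<^sub>R (F n x - f x)))"
      unfolding split_def by (rule norm_sum)
    also have "\<dots> \<le> R"
      unfolding R_def
    proof (rule sum_mono)
      fix y assume y: "y \<in> p"
      obtain x k where xk: "y = (x, k)" by (cases y)
      have "x \<in> {a..b}" using tagged_division_ofD(2,3)[OF p(1), of x k] y xk by auto
      then show "(case y of (x, k) \<Rightarrow> norm (measure lborel k *\<^sub>R (F n x - f x))) \<le> (case y of (x, k) \<Rightarrow> measure lborel k *\<^sub>R g n x)"
        using le by (auto simp: xk intro!: mult_left_mono)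
    qed
    finally have "norm (Q - P) \<le> R" .
    moreover have "norm (Q - I n) < e / 4" "norm (R - J n) < e / 4"
      using dd[OF p(1)] dd'[OF p(1)] p(2) by (auto simp: Q_def R_def fine_Int)
    moreover have "norm (P - i) \<le> norm (Q - P) + norm (Q - I n) + norm (I n - i)"
      using norm_triangle_ineq[of "Q - I n" "I n - i"] norm_triangle_ineq[of "P - Q" "Q - i"]
      by (simp add: norm_minus_commute)
    ultimately have "norm (P - i) < e" using n unfolding real_norm_def by linarith
    then show ?thesis by (simp add: P_def)
  qed
  then show "\<exists>\<gamma>. gauge \<gamma> \<and> (\<forall>\<D>. \<D> tagged_division_of {a..b} \<and> \<gamma> fine \<D> \<longrightarrow>
      norm ((\<Sum>(x, k)\<in>\<D>. measure lborel k *\<^sub>R f x) - i) < e)"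
    using gauge_Int[OF d d'] by blast
qed

section \<open>Mild solutions\<close>

text \<open>
  The formula for mild solutions with the semigroup as a parameter: superposition of solutions makes
  sense only when they are driven by the same semigroup.
\<close>

definition mild_for ::
  "(real \<Rightarrow> 'a \<Rightarrow> 'a::real_normed_vector) \<Rightarrow> real \<Rightarrow> 'a \<Rightarrow> (real \<Rightarrow> 'a) \<Rightarrow> (real \<Rightarrow> 'a) \<Rightarrow> bool" where
  "mild_for R \<tau> x f z \<longleftrightarrow> continuous_on {0..\<tau>} z \<and>
     (\<forall>t\<in>{0..\<tau>}. ((\<lambda>s. R (s - t) (f s)) has_integral (R (\<tau> - t) x - z t)) {t..\<tau>})"

lemma mild_solution_iff_mild_for:
  fixes R :: "real \<Rightarrow> 'a \<Rightarrow> 'a::{real_inner, complete_space}"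
  assumes gen: "generates L R"
  shows "mild_solution L \<tau> x f z \<longleftrightarrow> mild_for R \<tau> x f z"
proof
  assume "mild_solution L \<tau> x f z"
  then obtain R' where R': "generates L R'" and z: "mild_for R' \<tau> x f z"
    unfolding mild_solution_def mild_for_def by blast
  have eq: "R' t = R t" if "0 \<le> t" for t
    using semigroup_unique[of R' R t] gen R' that by (auto simp: generates_def)
  have "((\<lambda>s. R (s - t) (f s)) has_integral (R (\<tau> - t) x - z t)) {t..\<tau>}" if t: "t \<in> {0..\<tau>}" for t
  proof (rule has_integral_eq)
    show "R' (s - t) (f s) = R (s - t) (f s)" if "s \<in> {t..\<tau>}" for s using eq that by simp
    have "((\<lambda>s. R' (s - t) (f s)) has_integral (R' (\<tau> - t) x - z t)) {t..\<tau>}"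
      using z t by (simp add: mild_for_def)
    then show "((\<lambda>s. R' (s - t) (f s)) has_integral (R (\<tau> - t) x - z t)) {t..\<tau>}"
      using eq[of "\<tau> - t"] t by simp
  qed
  then show "mild_for R \<tau> x f z" using z by (simp add: mild_for_def)
next
  assume "mild_for R \<tau> x f z"
  then show "mild_solution L \<tau> x f z" using gen unfolding mild_solution_def mild_for_def by blast
qed

lemma mild_for_add:
  assumes R: "C0_semigroup R" and z: "mild_for R \<tau> x f z" and z': "mild_for R \<tau> x' f' z'"
  shows "mild_for R \<tau> (x + x') (\<lambda>t. f t + f' t) (\<lambda>t. z t + z' t)"
  unfolding mild_for_def
proof (intro conjI ballI)
  show "continuous_on {0..\<tau>} (\<lambda>t. z t + z' t)"
    using z z' by (auto simp: mild_for_def intro: continuous_on_add)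
  fix t assume t: "t \<in> {0..\<tau>}"
  have lin: "bounded_linear (R r)" if "0 \<le> r" for r using R that by (simp add: C0_semigroup_def)
  have "((\<lambda>s. R (s - t) (f s) + R (s - t) (f' s)) has_integral
      (R (\<tau> - t) x - z t) + (R (\<tau> - t) x' - z' t)) {t..\<tau>}"
    using z z' t by (intro has_integral_add) (auto simp: mild_for_def)
  moreover have "R (s - t) (f s) + R (s - t) (f' s) = R (s - t) (f s + f' s)" if "s \<in> {t..\<tau>}" for s
    using that by (simp add: linear_simps(1)[OF lin])
  ultimately have "((\<lambda>s. R (s - t) (f s + f' s)) has_integral
      (R (\<tau> - t) x - z t) + (R (\<tau> - t) x' - z' t)) {t..\<tau>}"
    by (rule has_integral_eq[rotated])
  moreover have "(R (\<tau> - t) x - z t) + (R (\<tau> - t) x' - z' t) = R (\<tau> - t) (x + x') - (z t + z' t)"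
    using t by (simp add: linear_simps(1)[OF lin])
  ultimately show "((\<lambda>s. R (s - t) (f s + f' s)) has_integral R (\<tau> - t) (x + x') - (z t + z' t)) {t..\<tau>}"
    by (simp only:)
qed

lemma mild_for_scaleR:
  assumes R: "C0_semigroup R" and z: "mild_for R \<tau> x f z"
  shows "mild_for R \<tau> (c *\<^sub>R x) (\<lambda>t. c *\<^sub>R f t) (\<lambda>t. c *\<^sub>R z t)"
  unfolding mild_for_def
proof (intro conjI ballI)
  show "continuous_on {0..\<tau>} (\<lambda>t. c *\<^sub>R z t)"
    using z by (auto simp: mild_for_def intro: continuous_on_scaleR continuous_on_const)
  fix t assume t: "t \<in> {0..\<tau>}"
  have lin: "bounded_linear (R r)" if "0 \<le> r" for r using R that by (simp add: C0_semigroup_def)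
  have "((\<lambda>s. c *\<^sub>R R (s - t) (f s)) has_integral c *\<^sub>R (R (\<tau> - t) x - z t)) {t..\<tau>}"
    using z t by (intro has_integral_cmul) (auto simp: mild_for_def)
  moreover have "c *\<^sub>R R (s - t) (f s) = R (s - t) (c *\<^sub>R f s)" if "s \<in> {t..\<tau>}" for s
    using that by (simp add: linear_simps(5)[OF lin])
  ultimately have "((\<lambda>s. R (s - t) (c *\<^sub>R f s)) has_integral c *\<^sub>R (R (\<tau> - t) x - z t)) {t..\<tau>}"
    by (rule has_integral_eq[rotated])
  moreover have "c *\<^sub>R (R (\<tau> - t) x - z t) = R (\<tau> - t) (c *\<^sub>R x) - c *\<^sub>R z t"
    using t by (simp add: linear_simps(5)[OF lin] scaleR_diff_right)
  ultimately show "((\<lambda>s. R (s - t) (c *\<^sub>R f s)) has_integral R (\<tau> - t) (c *\<^sub>R x) - c *\<^sub>R z t) {t..\<tau>}"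
    by (simp only:)
qed

lemma mild_for_diff:
  assumes R: "C0_semigroup R" and z: "mild_for R \<tau> x f z" and z': "mild_for R \<tau> x' f' z'"
  shows "mild_for R \<tau> (x - x') (\<lambda>t. f t - f' t) (\<lambda>t. z t - z' t)"
proof -
  have "mild_for R \<tau> (x + (- 1) *\<^sub>R x') (\<lambda>t. f t + (- 1) *\<^sub>R f' t) (\<lambda>t. z t + (- 1) *\<^sub>R z' t)"
    by (intro mild_for_add mild_for_scaleR assms)
  then show ?thesis by simp
qed

lemma mild_for_homogeneous:
  fixes R :: "real \<Rightarrow> 'a \<Rightarrow> 'a::{real_normed_vector, complete_space}"
  assumes R: "C0_semigroup R"
  shows "mild_for R \<tau> x (\<lambda>t. 0) (\<lambda>t. R (\<tau> - t) x)"
  unfolding mild_for_def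
proof (intro conjI ballI)
  show "continuous_on {0..\<tau>} (\<lambda>t. R (\<tau> - t) x)"
    by (rule continuous_on_compose2[OF C0_semigroup_orbit_continuous[OF R, of \<tau>]])
       (auto intro!: continuous_intros)
  fix t assume "t \<in> {0..\<tau>}"
  have "R (s - t) 0 = 0" if "s \<in> {t..\<tau>}" for s
    using R that by (simp add: C0_semigroup_def linear_simps(3))
  then show "((\<lambda>s. R (s - t) 0) has_integral R (\<tau> - t) x - R (\<tau> - t) x) {t..\<tau>}"
    using has_integral_is_0[of "{t..\<tau>}" "\<lambda>s. R (s - t) 0"] by simp
qed

text \<open>
  Duhamel's formula together with the bound of the semigroup on \<open>[0,T]\<close>.  One constant serves all
  final times \<open>\<tau> \<le> T\<close>, which allows the evolution to be started from an intermediate time.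
\<close>

lemma mild_for_bound:
  fixes R :: "real \<Rightarrow> 'a \<Rightarrow> 'a::{real_inner, complete_space}"
  assumes R: "C0_semigroup R" and T: "0 < T"
  obtains K where "0 < K"
    "\<And>\<tau> x f z t. \<lbrakk>\<tau> \<le> T; f \<in> L2 T; mild_for R \<tau> x f z; t \<in> {0..\<tau>}\<rbrakk>
      \<Longrightarrow> norm (z t) \<le> K * (norm x + L2_norm T f)"
proof -
  obtain M where M: "0 < M" "\<And>t x. 0 \<le> t \<Longrightarrow> t \<le> T \<Longrightarrow> norm (R t x) \<le> M * norm x"
    using C0_semigroup_bounded[OF R, of T] by blast
  have "norm (z t) \<le> (M + M * sqrt T) * (norm x + L2_norm T f)"
    if \<tau>: "\<tau> \<le> T" and f: "f \<in> L2 T" and z: "mild_for R \<tau> x f z" and t: "t \<in> {0..\<tau>}" for \<tau> x f z t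
  proof -
    have int: "(\<lambda>s. norm (f s)) integrable_on {t..\<tau>}" "integral {t..\<tau>} (\<lambda>s. norm (f s)) \<le> sqrt T * L2_norm T f"
      using L2_norm_integral[OF T f] \<tau> t by auto
    have "norm (R (\<tau> - t) x - z t) \<le> integral {t..\<tau>} (\<lambda>s. M * norm (f s))"
    proof (rule has_integral_norm_le)
      show "((\<lambda>s. R (s - t) (f s)) has_integral (R (\<tau> - t) x - z t)) {t..\<tau>}"
        using z t by (simp add: mild_for_def)
      show "(\<lambda>s. M * norm (f s)) integrable_on {t..\<tau>}" using integrable_on_cmult_left[OF int(1), of M] by simp
      show "norm (R (s - t) (f s)) \<le> M * norm (f s)" if "s \<in> {t..\<tau>}" for s
        using that t \<tau> by (intro M(2)) auto
    qed
    also have "\<dots> = M * integral {t..\<tau>} (\<lambda>s. norm (f s))" by simp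
    also have "\<dots> \<le> M * (sqrt T * L2_norm T f)" using M int(2) by (intro mult_left_mono) auto
    finally have "norm (R (\<tau> - t) x - z t) \<le> M * sqrt T * L2_norm T f" by (simp add: mult.assoc)
    moreover have "norm (R (\<tau> - t) x) \<le> M * norm x" using t \<tau> by (intro M(2)) auto
    moreover have "norm (z t) \<le> norm (R (\<tau> - t) x) + norm (R (\<tau> - t) x - z t)"
      using norm_triangle_ineq4[of "R (\<tau> - t) x" "R (\<tau> - t) x - z t"] by simp
    moreover have "0 \<le> M * sqrt T * norm x" "0 \<le> M * L2_norm T f"
      using M T by (auto simp: L2_norm_nonneg)
    ultimately show ?thesis unfolding distrib_left distrib_right by linarith
  qed
  moreover have "0 < M + M * sqrt T" using M T by (simp add: add_pos_nonneg)
  ultimately show thesis using that by blast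
qed

text \<open>
  The operator \<open>R (\<tau> - t)\<close> carries the integral over \<open>{\<tau>..T}\<close> in the formula for \<open>z \<tau>\<close> to the part
  over \<open>{\<tau>..T}\<close> of the integral in the formula for \<open>z t\<close>; the rest is the integral over \<open>{t..\<tau>}\<close>.
\<close>

lemma mild_for_restrict:
  fixes R :: "real \<Rightarrow> 'a \<Rightarrow> 'a::{real_normed_vector, complete_space}"
  assumes R: "C0_semigroup R" and z: "mild_for R T x f z" and \<tau>: "0 \<le> \<tau>" "\<tau> \<le> T"
  shows "mild_for R \<tau> (z \<tau>) f z"
  unfolding mild_for_def
proof (intro conjI ballI)
  show "continuous_on {0..\<tau>} z"
    using z \<tau> by (auto simp: mild_for_def intro: continuous_on_subset)
  fix t assume t: "t \<in> {0..\<tau>}"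
  have lin: "bounded_linear (R (\<tau> - t))" using R t by (simp add: C0_semigroup_def)
  have "((\<lambda>s. R (s - t) (f s)) has_integral (R (T - t) x - z t)) {t..T}"
    using z t \<tau> by (simp add: mild_for_def)
  moreover have "((\<lambda>s. R (s - t) (f s)) has_integral (R (T - t) x - R (\<tau> - t) (z \<tau>))) {\<tau>..T}"
  proof -
    have "((\<lambda>s. R (s - \<tau>) (f s)) has_integral (R (T - \<tau>) x - z \<tau>)) {\<tau>..T}"
      using z \<tau> by (simp add: mild_for_def)
    from has_integral_linear[OF this lin]
    have "((\<lambda>s. R (\<tau> - t) (R (s - \<tau>) (f s))) has_integral R (\<tau> - t) (R (T - \<tau>) x - z \<tau>)) {\<tau>..T}"
      by (simp add: o_def)
    moreover have "R (\<tau> - t) (R (s - \<tau>) y) = R (s - t) y" if "s \<in> {\<tau>..T}" for s y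
      using C0_semigroup_add[OF R, of "\<tau> - t" "s - \<tau>" y] that t by simp
    ultimately have "((\<lambda>s. R (s - t) (f s)) has_integral R (\<tau> - t) (R (T - \<tau>) x - z \<tau>)) {\<tau>..T}"
      using has_integral_eq[of "{\<tau>..T}" "\<lambda>s. R (\<tau> - t) (R (s - \<tau>) (f s))"] by simp
    moreover have "R (\<tau> - t) (R (T - \<tau>) x - z \<tau>) = R (T - t) x - R (\<tau> - t) (z \<tau>)"
      using C0_semigroup_add[OF R, of "\<tau> - t" "T - \<tau>" x] t \<tau> by (simp add: linear_simps(2)[OF lin])
    ultimately show ?thesis by simp
  qed
  ultimately have "((\<lambda>s. R (s - t) (f s)) has_integral
      ((R (T - t) x - z t) - (R (T - t) x - R (\<tau> - t) (z \<tau>)))) {t..\<tau>}"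
    using t \<tau> by (intro has_integral_subtract_right[of t \<tau> T]) auto
  then show "((\<lambda>s. R (s - t) (f s)) has_integral R (\<tau> - t) (z \<tau>) - z t) {t..\<tau>}" by simp
qed

text \<open>
  Differences of the solutions are solutions with small data, hence uniformly small; this gives the
  limit function.  Its integral formula is the limit of the formulas of the approximating solutions.
\<close>

lemma mild_for_limit:
  fixes R :: "real \<Rightarrow> 'a \<Rightarrow> 'a::{real_inner, complete_space}"
  assumes R: "C0_semigroup R" and \<tau>: "0 < \<tau>"
    and z: "\<And>n::nat. mild_for R \<tau> (X n) (F n) (Z n)"
    and F: "\<And>n. F n \<in> L2 \<tau>" and f: "f \<in> L2 \<tau>" "(\<lambda>n. L2_norm \<tau> (\<lambda>t. F n t - f t)) \<longlonglongrightarrow> 0"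
    and X: "X \<longlonglongrightarrow> x"
  obtains z where "mild_for R \<tau> x f z" "uniform_limit {0..\<tau>} Z z sequentially"
proof -
  obtain K where K: "0 < K" "\<And>\<sigma> x f z t. \<lbrakk>\<sigma> \<le> \<tau>; f \<in> L2 \<tau>; mild_for R \<sigma> x f z; t \<in> {0..\<sigma>}\<rbrakk>
      \<Longrightarrow> norm (z t) \<le> K * (norm x + L2_norm \<tau> f)"
    using mild_for_bound[OF R \<tau>] by blast
  obtain M where M: "0 < M" "\<And>t x. 0 \<le> t \<Longrightarrow> t \<le> \<tau> \<Longrightarrow> norm (R t x) \<le> M * norm x"
    using C0_semigroup_bounded[OF R, of \<tau>] by blast
  define e where "e n = norm (X n - x) + L2_norm \<tau> (\<lambda>t. F n t - f t)" for n
  have e: "e \<longlonglongrightarrow> 0"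
    unfolding e_def using tendsto_add[OF tendsto_norm_zero[OF LIM_zero[OF X]] f(2)] by simp
  have close: "norm (Z m t - Z n t) \<le> K * (e m + e n)" if t: "t \<in> {0..\<tau>}" for m n t
  proof -
    have "norm (Z m t - Z n t) \<le> K * (norm (X m - X n) + L2_norm \<tau> (\<lambda>t. F m t - F n t))"
      using K(2)[OF order_refl L2_diff[OF F F] mild_for_diff[OF R z z] t] .
    also have "\<dots> \<le> K * (e m + e n)"
    proof (rule mult_left_mono)
      have "L2_norm \<tau> (\<lambda>t. (F m t - f t) - (F n t - f t))
          \<le> L2_norm \<tau> (\<lambda>t. F m t - f t) + L2_norm \<tau> (\<lambda>t. F n t - f t)"
        by (intro L2_norm_diff_triangle L2_diff F f)
      moreover have "norm (X m - X n) \<le> norm (X m - x) + norm (X n - x)"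
        using norm_triangle_ineq4[of "X m - x" "X n - x"] by simp
      ultimately show "norm (X m - X n) + L2_norm \<tau> (\<lambda>t. F m t - F n t) \<le> e m + e n"
        by (simp add: e_def)
    qed (use K in simp)
    finally show ?thesis .
  qed
  have "uniformly_convergent_on {0..\<tau>} Z"
  proof (rule Cauchy_uniformly_convergent, rule uniformly_Cauchy_onI)
    fix r :: real assume r: "0 < r"
    have "\<forall>\<^sub>F n in sequentially. dist (e n) 0 < r / (2 * K)"
      using r K by (intro tendstoD[OF e]) simp
    then obtain N where N: "\<And>n. n \<ge> N \<Longrightarrow> \<bar>e n\<bar> < r / (2 * K)"
      unfolding eventually_sequentially by (auto simp: dist_norm)
    have "dist (Z m t) (Z n t) < r" if "t \<in> {0..\<tau>}" "m \<ge> N" "n \<ge> N" for t m n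
    proof -
      have "e m + e n < r / (2 * K) + r / (2 * K)" using N[OF that(2)] N[OF that(3)] by linarith
      then have "K * (e m + e n) < r" using K(1) by (simp add: field_simps)
      then show ?thesis using close[OF that(1), of m n] by (simp add: dist_norm)
    qed
    then show "\<exists>N. \<forall>t\<in>{0..\<tau>}. \<forall>m\<ge>N. \<forall>n\<ge>N. dist (Z m t) (Z n t) < r" by blast
  qed
  then obtain z0 where lim: "uniform_limit {0..\<tau>} Z z0 sequentially"
    unfolding uniformly_convergent_on_def by blast
  have "mild_for R \<tau> x f z0"
    unfolding mild_for_def
  proof (intro conjI ballI)
    show "continuous_on {0..\<tau>} z0"
      by (rule uniform_limit_theorem[OF _ lim]) (use z in \<open>auto simp: mild_for_def\<close>)
    fix t assume t: "t \<in> {0..\<tau>}"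
    show "((\<lambda>s. R (s - t) (f s)) has_integral R (\<tau> - t) x - z0 t) {t..\<tau>}"
    proof (rule has_integral_L1_limit)
      show "((\<lambda>s. R (s - t) (F n s)) has_integral R (\<tau> - t) (X n) - Z n t) {t..\<tau>}" for n
        using z[of n] t by (simp add: mild_for_def)
      have "bounded_linear (R (\<tau> - t))" using R t by (simp add: C0_semigroup_def)
      from tendsto_diff[OF bounded_linear.tendsto[OF this X] tendsto_uniform_limitI[OF lim t]]
      show "(\<lambda>n. R (\<tau> - t) (X n) - Z n t) \<longlonglongrightarrow> R (\<tau> - t) x - z0 t" .
      have int: "(\<lambda>s. norm (F n s - f s)) integrable_on {t..\<tau>}"
        "integral {t..\<tau>} (\<lambda>s. norm (F n s - f s)) \<le> sqrt \<tau> * L2_norm \<tau> (\<lambda>t. F n t - f t)" for n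
        using L2_norm_integral[OF \<tau> L2_diff[OF F[of n] f(1)], of t \<tau>] t by auto
      show "((\<lambda>s. M * norm (F n s - f s)) has_integral M * integral {t..\<tau>} (\<lambda>s. norm (F n s - f s))) {t..\<tau>}" for n
        by (intro has_integral_mult_right integrable_integral int)
      have "(\<lambda>n. integral {t..\<tau>} (\<lambda>s. norm (F n s - f s))) \<longlonglongrightarrow> 0"
      proof (rule tendsto_sandwich[where f="\<lambda>_. 0" and h="\<lambda>n. sqrt \<tau> * L2_norm \<tau> (\<lambda>t. F n t - f t)"])
        show "(\<lambda>n. sqrt \<tau> * L2_norm \<tau> (\<lambda>t. F n t - f t)) \<longlonglongrightarrow> 0"
          by (rule tendsto_mult_right_zero[OF f(2)])
      qed (use int in \<open>auto intro!: always_eventually integral_nonneg\<close>)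
      then show "(\<lambda>n. M * integral {t..\<tau>} (\<lambda>s. norm (F n s - f s))) \<longlonglongrightarrow> 0"
        by (rule tendsto_mult_right_zero)
      show "norm (R (s - t) (F n s) - R (s - t) (f s)) \<le> M * norm (F n s - f s)" if "s \<in> {t..\<tau>}" for n s
      proof -
        have "bounded_linear (R (s - t))" using R that by (simp add: C0_semigroup_def)
        then have "R (s - t) (F n s) - R (s - t) (f s) = R (s - t) (F n s - f s)"
          by (simp add: linear_simps(2))
        then show ?thesis using M(2)[of "s - t" "F n s - f s"] that t by simp
      qed
    qed
  qed
  then show thesis using lim that by blast
qed

section \<open>Seminorms on finite-dimensional spaces\<close>

text \<open>
  Subspaces of \<open>L\<^sup>2\<close> consist of functions, whose types carry no vector space structure; their finite-dimensional
  subspaces are therefore described by families of coefficients.  The second condition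
  is stated as an inequality, which is easier to verify; together the two conditions imply
  homogeneity and nonnegativity.
\<close>

definition coeff_seminorm :: "(('i \<Rightarrow> real) \<Rightarrow> real) \<Rightarrow> bool" where
  "coeff_seminorm P \<longleftrightarrow> (\<forall>c d. P (\<lambda>i. c i + d i) \<le> P c + P d) \<and>
     (\<forall>a c. P (\<lambda>i. a * c i) \<le> \<bar>a\<bar> * P c)"

abbreviation unit_coeff :: "'i \<Rightarrow> 'i \<Rightarrow> real" where
  "unit_coeff j \<equiv> (\<lambda>i. if i = j then 1 else 0)"

definition supported :: "'i set \<Rightarrow> ('i \<Rightarrow> real) \<Rightarrow> bool" where
  "supported J c \<longleftrightarrow> (\<forall>i. i \<notin> J \<longrightarrow> c i = 0)"

lemma coeff_seminorm_add: "coeff_seminorm P \<Longrightarrow> P (\<lambda>i. c i + d i) \<le> P c + P d"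
  by (simp add: coeff_seminorm_def)

lemma coeff_seminorm_scale: "coeff_seminorm P \<Longrightarrow> P (\<lambda>i. a * c i) \<le> \<bar>a\<bar> * P c"
  by (simp add: coeff_seminorm_def)

lemma coeff_seminorm_diff:
  assumes P: "coeff_seminorm P"
  shows "P (\<lambda>i. c i - d i) \<le> P c + P d"
  using coeff_seminorm_add[OF P, of c "\<lambda>i. (- 1) * d i"] coeff_seminorm_scale[OF P, of "- 1" d] by simp

lemma coeff_seminorm_zero:
  assumes P: "coeff_seminorm P"
  shows "P (\<lambda>i. 0) = 0"
  using coeff_seminorm_add[OF P, of "\<lambda>i. 0" "\<lambda>i. 0"] coeff_seminorm_scale[OF P, of 0 "\<lambda>i. 0"] by simp

lemma coeff_seminorm_nonneg:
  assumes P: "coeff_seminorm P"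
  shows "0 \<le> P c"
  using coeff_seminorm_diff[OF P, of c c] coeff_seminorm_zero[OF P] by simp

lemma coeff_seminorm_le_sum:
  assumes P: "coeff_seminorm P" and J: "finite J" and c: "supported J c"
  shows "P c \<le> (\<Sum>j\<in>J. \<bar>c j\<bar> * P (unit_coeff j))"
  using J c
proof (induction J arbitrary: c rule: finite_induct)
  case empty
  then have "c = (\<lambda>i. 0)" by (auto simp: supported_def)
  then show ?case using coeff_seminorm_zero[OF P] by simp
next
  case (insert j J)
  define d where "d = c(j := 0)"
  have "c = (\<lambda>i. c j * unit_coeff j i + d i)" by (auto simp: d_def)
  then have "P c \<le> P (\<lambda>i. c j * unit_coeff j i) + P d" using coeff_seminorm_add[OF P] by metis
  also have "P (\<lambda>i. c j * unit_coeff j i) \<le> \<bar>c j\<bar> * P (unit_coeff j)" by (rule coeff_seminorm_scale[OF P])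
  also have "P d \<le> (\<Sum>i\<in>J. \<bar>d i\<bar> * P (unit_coeff i))"
    using insert.prems by (intro insert.IH) (auto simp: supported_def d_def)
  also have "\<dots> = (\<Sum>i\<in>J. \<bar>c i\<bar> * P (unit_coeff i))"
    using insert.hyps by (intro sum.cong) (auto simp: d_def)
  finally show ?case using insert.hyps by simp
qed

text \<open>
  A basis modulo the kernel of \<open>P\<close> whose coordinates are controlled by \<open>P\<close>.  It grows by one
  unit vector at a time: either the new vector is, up to the kernel, a combination of the old ones, or it has
  positive distance from their span.  That one of the two occurs is because a distance \<open>0\<close> would be attained:
  the coordinates of a minimising sequence converge.
\<close>

lemma coeff_seminorm_basis:
  assumes P: "coeff_seminorm P" and I: "finite I"
  shows "\<exists>J\<subseteq>I. \<exists>K\<ge>0. (\<forall>c. supported J c \<longrightarrow> (\<Sum>j\<in>J. \<bar>c j\<bar>) \<le> K * P c) \<and>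
    (\<forall>i\<in>I. \<exists>d. supported J d \<and> P (\<lambda>k. unit_coeff i k - d k) = 0)"
  using I
proof (induction I rule: finite_induct)
  case empty
  show ?case by (intro exI[of _ "{}"] conjI exI[of _ 0]) auto
next
  case (insert v I)
  then obtain J K where J: "J \<subseteq> I" and K: "0 \<le> K"
    and bound: "\<And>c. supported J c \<Longrightarrow> (\<Sum>j\<in>J. \<bar>c j\<bar>) \<le> K * P c"
    and span: "\<And>i. i \<in> I \<Longrightarrow> \<exists>d. supported J d \<and> P (\<lambda>k. unit_coeff i k - d k) = 0" by metis
  have finJ: "finite J" "v \<notin> J" using J insert.hyps finite_subset by auto
  show ?case
  proof (cases "\<exists>d. supported J d \<and> P (\<lambda>k. unit_coeff v k - d k) = 0")
    case True
    then show ?thesis using J K bound span by (intro exI[of _ J]) auto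
  next
    case False
    have "\<exists>\<delta>>0. \<forall>d. supported J d \<longrightarrow> \<delta> \<le> P (\<lambda>k. unit_coeff v k - d k)"
    proof (rule ccontr)
      assume neg: "\<not> ?thesis"
      have "\<exists>d. supported J d \<and> P (\<lambda>k. unit_coeff v k - d k) < 1 / Suc n" for n
        using neg by (metis not_le of_nat_0_less_iff zero_less_Suc zero_less_divide_1_iff)
      then obtain D where D: "\<And>n. supported J (D n)"
        and small: "\<And>n. P (\<lambda>k. unit_coeff v k - D n k) < 1 / Suc n" by metis
      have inv0: "(\<lambda>n. 1 / real (Suc n)) \<longlonglongrightarrow> 0"
        using LIMSEQ_inverse_real_of_nat by (simp add: inverse_eq_divide)
      have diff: "\<bar>D m j - D n j\<bar> \<le> K * (1 / Suc m + 1 / Suc n)" if j: "j \<in> J" for j m n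
      proof -
        have "\<bar>D m j - D n j\<bar> \<le> (\<Sum>j\<in>J. \<bar>D m j - D n j\<bar>)"
          using member_le_sum[OF j, of "\<lambda>j. \<bar>D m j - D n j\<bar>"] finJ by simp
        also have "\<dots> \<le> K * P (\<lambda>k. D m k - D n k)"
          using D by (intro bound) (auto simp: supported_def)
        also have "P (\<lambda>k. D m k - D n k) \<le> 1 / Suc m + 1 / Suc n"
          using coeff_seminorm_diff[OF P, of "\<lambda>k. unit_coeff v k - D n k" "\<lambda>k. unit_coeff v k - D m k"]
            small[of m] small[of n] by simp
        finally show ?thesis using K by (simp add: mult_left_mono)
      qed
      have "convergent (\<lambda>n. D n j)" if j: "j \<in> J" for j
      proof (rule Cauchy_convergent, rule metric_CauchyI)
        fix e :: real assume e: "0 < e"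
        have "(\<lambda>n. K * (1 / Suc n)) \<longlonglongrightarrow> 0" by (rule tendsto_mult_right_zero[OF inv0])
        then have "\<forall>\<^sub>F n in sequentially. K * (1 / Suc n) < e / 2"
          using e by (intro order_tendstoD(2)) auto
        then obtain N where N: "\<And>n. n \<ge> N \<Longrightarrow> K * (1 / Suc n) < e / 2"
          unfolding eventually_sequentially by blast
        have "dist (D m j) (D n j) < e" if "m \<ge> N" "n \<ge> N" for m n
          using diff[OF j, of m n] N[OF that(1)] N[OF that(2)] unfolding dist_real_def distrib_left by linarith
        then show "\<exists>M. \<forall>m\<ge>M. \<forall>n\<ge>M. dist (D m j) (D n j) < e" by blast
      qed
      then obtain d0 where d0: "\<And>j. j \<in> J \<Longrightarrow> (\<lambda>n. D n j) \<longlonglongrightarrow> d0 j"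
        unfolding convergent_def by metis
      define d where "d = (\<lambda>j. if j \<in> J then d0 j else 0)"
      have d: "supported J d" by (simp add: supported_def d_def)
      have "P (\<lambda>k. unit_coeff v k - d k) \<le> 1 / Suc n + (\<Sum>j\<in>J. \<bar>D n j - d0 j\<bar> * P (unit_coeff j))" for n
      proof -
        have "P (\<lambda>k. unit_coeff v k - d k) \<le> P (\<lambda>k. unit_coeff v k - D n k) + P (\<lambda>k. D n k - d k)"
          using coeff_seminorm_add[OF P, of "\<lambda>k. unit_coeff v k - D n k" "\<lambda>k. D n k - d k"] by simp
        moreover have "P (\<lambda>k. D n k - d k) \<le> (\<Sum>j\<in>J. \<bar>D n j - d j\<bar> * P (unit_coeff j))"
          using D d by (intro coeff_seminorm_le_sum[OF P finJ(1)]) (auto simp: supported_def)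
        ultimately show ?thesis using small[of n] by (simp add: d_def)
      qed
      moreover have "(\<lambda>n. 1 / Suc n + (\<Sum>j\<in>J. \<bar>D n j - d0 j\<bar> * P (unit_coeff j))) \<longlonglongrightarrow> 0 + (\<Sum>j\<in>J. 0)"
        using inv0 d0 by (intro tendsto_add tendsto_sum tendsto_mult_left_zero tendsto_rabs_zero LIM_zero) auto
      ultimately have "P (\<lambda>k. unit_coeff v k - d k) \<le> 0 + (\<Sum>j\<in>J. 0)"
        by (intro LIMSEQ_le_const) auto
      then show False
        using False d coeff_seminorm_nonneg[OF P, of "\<lambda>k. unit_coeff v k - d k"] by auto
    qed
    then obtain \<delta> where \<delta>: "0 < \<delta>" "\<And>d. supported J d \<Longrightarrow> \<delta> \<le> P (\<lambda>k. unit_coeff v k - d k)" by blast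
    define K' where "K' = 1 / \<delta> + K + K * P (unit_coeff v) / \<delta>"
    have Pv: "0 \<le> P (unit_coeff v)" by (rule coeff_seminorm_nonneg[OF P])
    have "(\<Sum>j\<in>insert v J. \<bar>c j\<bar>) \<le> K' * P c" if c: "supported (insert v J) c" for c
    proof -
      define a where "a = c v"
      define c' where "c' = c(v := 0)"
      have c': "supported J c'" using c by (auto simp: supported_def c'_def)
      have a: "\<bar>a\<bar> \<le> P c / \<delta>"
      proof (cases "a = 0")
        case True
        then show ?thesis using \<delta> coeff_seminorm_nonneg[OF P, of c] by simp
      next
        case False
        have "\<delta> \<le> P (\<lambda>k. unit_coeff v k - (- 1 / a) * c' k)"
          using c' by (intro \<delta>(2)) (simp add: supported_def)
        also have "(\<lambda>k. unit_coeff v k - (- 1 / a) * c' k) = (\<lambda>k. (1 / a) * c k)"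
          using False by (auto simp: c'_def a_def fun_eq_iff)
        also have "P \<dots> \<le> \<bar>1 / a\<bar> * P c" by (rule coeff_seminorm_scale[OF P])
        finally show ?thesis using \<delta> False by (simp add: field_simps)
      qed
      have "P c' \<le> P c + \<bar>a\<bar> * P (unit_coeff v)"
      proof -
        have "c' = (\<lambda>k. c k - a * unit_coeff v k)" by (auto simp: c'_def a_def)
        then have "P c' \<le> P c + P (\<lambda>k. a * unit_coeff v k)" using coeff_seminorm_diff[OF P] by metis
        also have "P (\<lambda>k. a * unit_coeff v k) \<le> \<bar>a\<bar> * P (unit_coeff v)" by (rule coeff_seminorm_scale[OF P])
        finally show ?thesis by simp
      qed
      also have "\<bar>a\<bar> * P (unit_coeff v) \<le> P c / \<delta> * P (unit_coeff v)" using a Pv by (rule mult_right_mono)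
      finally have "K * P c' \<le> K * (P c + P c / \<delta> * P (unit_coeff v))" using K by (intro mult_left_mono) auto
      moreover have "(\<Sum>j\<in>J. \<bar>c j\<bar>) = (\<Sum>j\<in>J. \<bar>c' j\<bar>)" using finJ by (intro sum.cong) (auto simp: c'_def)
      moreover have "(\<Sum>j\<in>insert v J. \<bar>c j\<bar>) = \<bar>a\<bar> + (\<Sum>j\<in>J. \<bar>c j\<bar>)" using finJ by (simp add: a_def)
      moreover have "K' * P c = P c / \<delta> + K * (P c + P c / \<delta> * P (unit_coeff v))"
        by (simp add: K'_def algebra_simps)
      ultimately show ?thesis using a bound[OF c'] by linarith
    qed
    moreover have "\<exists>d. supported (insert v J) d \<and> P (\<lambda>k. unit_coeff i k - d k) = 0" if i: "i \<in> insert v I" for i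
    proof (cases "i = v")
      case True
      then show ?thesis using coeff_seminorm_zero[OF P] by (intro exI[of _ "unit_coeff v"]) (auto simp: supported_def)
    next
      case False
      then show ?thesis using span[of i] i by (auto simp: supported_def)
    qed
    moreover have "0 \<le> K'" using \<delta> K Pv by (simp add: K'_def)
    moreover have "insert v J \<subseteq> insert v I" using J by auto
    ultimately show ?thesis by blast
  qed
qed

text \<open>
  Modulo the kernel of \<open>P\<close>, on which \<open>Q\<close> vanishes, every vector is a combination of the basis above,
  and \<open>Q\<close> of a combination is at most a multiple of the sum of its absolute coordinates.
\<close>

lemma finite_dim_seminorm_le:
  assumes P: "coeff_seminorm P" and Q: "coeff_seminorm Q" and I: "finite I"
    and ker: "\<And>c. supported I c \<Longrightarrow> P c = 0 \<Longrightarrow> Q c = 0"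
  shows "\<exists>K. \<forall>c. supported I c \<longrightarrow> Q c \<le> K * P c"
proof -
  obtain J K where J: "J \<subseteq> I" and K: "0 \<le> K"
    and bound: "\<And>c. supported J c \<Longrightarrow> (\<Sum>j\<in>J. \<bar>c j\<bar>) \<le> K * P c"
    and span: "\<And>i. i \<in> I \<Longrightarrow> \<exists>d. supported J d \<and> P (\<lambda>k. unit_coeff i k - d k) = 0"
    using coeff_seminorm_basis[OF P I] by metis
  have finJ: "finite J" using J I finite_subset by auto
  have "\<forall>i. \<exists>d. i \<in> I \<longrightarrow> supported J d \<and> P (\<lambda>k. unit_coeff i k - d k) = 0" using span by blast
  then obtain d where d: "\<And>i. i \<in> I \<Longrightarrow> supported J (d i)"
    "\<And>i. i \<in> I \<Longrightarrow> P (\<lambda>k. unit_coeff i k - d i k) = 0" by metis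
  define m where "m = (\<Sum>j\<in>J. Q (unit_coeff j))"
  have m: "0 \<le> m" "\<And>j. j \<in> J \<Longrightarrow> Q (unit_coeff j) \<le> m"
    unfolding m_def using finJ coeff_seminorm_nonneg[OF Q]
    by (auto intro!: sum_nonneg member_le_sum[of _ J "\<lambda>j. Q (unit_coeff j)"])
  have "Q c \<le> m * K * P c" if c: "supported I c" for c
  proof -
    have "\<exists>e. supported J e \<and> P (\<lambda>k. c k - e k) = 0"
    proof (intro exI conjI)
      show "supported J (\<lambda>k. \<Sum>i\<in>I. c i * d i k)" using d by (simp add: supported_def)
      \<comment> \<open>the error of replacing each unit vector by its combination \<open>d i\<close>, itself a seminorm in \<open>c\<close>\<close>
      define P' where "P' c = P (\<lambda>k. c k - (\<Sum>i\<in>I. c i * d i k))" for c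
      have "coeff_seminorm P'"
        unfolding coeff_seminorm_def
      proof (intro conjI allI)
        fix b c
        have eq: "(\<lambda>k. (b k + c k) - (\<Sum>i\<in>I. (b i + c i) * d i k))
            = (\<lambda>k. (b k - (\<Sum>i\<in>I. b i * d i k)) + (c k - (\<Sum>i\<in>I. c i * d i k)))"
          by (simp add: fun_eq_iff distrib_right sum.distrib)
        show "P' (\<lambda>i. b i + c i) \<le> P' b + P' c" unfolding P'_def eq by (rule coeff_seminorm_add[OF P])
      next
        fix a c
        have eq: "(\<lambda>k. a * c k - (\<Sum>i\<in>I. (a * c i) * d i k)) = (\<lambda>k. a * (c k - (\<Sum>i\<in>I. c i * d i k)))"
          by (simp add: fun_eq_iff right_diff_distrib sum_distrib_left mult.assoc)
        show "P' (\<lambda>i. a * c i) \<le> \<bar>a\<bar> * P' c" unfolding P'_def eq by (rule coeff_seminorm_scale[OF P])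
      qed
      from coeff_seminorm_le_sum[OF this I c] have "P' c \<le> (\<Sum>j\<in>I. \<bar>c j\<bar> * P' (unit_coeff j))" .
      also have "\<dots> = 0"
      proof (intro sum.neutral ballI)
        fix j assume j: "j \<in> I"
        have "unit_coeff j i * d i k = (if i = j then d i k else 0)" for i k by simp
        then have "(\<Sum>i\<in>I. unit_coeff j i * d i k) = d j k" for k using I j by simp
        then have "P' (unit_coeff j) = P (\<lambda>k. unit_coeff j k - d j k)" by (simp only: P'_def)
        then show "\<bar>c j\<bar> * P' (unit_coeff j) = 0" using d(2)[OF j] by simp
      qed
      finally show "P (\<lambda>k. c k - (\<Sum>i\<in>I. c i * d i k)) = 0"
        using coeff_seminorm_nonneg[OF P] by (simp add: P'_def antisym)
    qed
    then obtain e where e: "supported J e" "P (\<lambda>k. c k - e k) = 0" by blast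
    have "Q (\<lambda>k. c k - e k) = 0" using e c J by (intro ker) (auto simp: supported_def)
    then have "Q c \<le> Q e" using coeff_seminorm_add[OF Q, of e "\<lambda>k. c k - e k"] by simp
    also have "\<dots> \<le> (\<Sum>j\<in>J. \<bar>e j\<bar> * Q (unit_coeff j))" by (rule coeff_seminorm_le_sum[OF Q finJ e(1)])
    also have "\<dots> \<le> (\<Sum>j\<in>J. \<bar>e j\<bar> * m)" by (intro sum_mono mult_left_mono m) auto
    also have "\<dots> = m * (\<Sum>j\<in>J. \<bar>e j\<bar>)" by (simp add: sum_distrib_left mult.commute)
    also have "\<dots> \<le> m * (K * P e)" using m bound[OF e(1)] by (intro mult_left_mono) auto
    also have "\<dots> \<le> m * (K * P c)"
      using m K e(2) coeff_seminorm_diff[OF P, of c "\<lambda>k. c k - e k"] by (intro mult_left_mono) auto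
    finally show ?thesis by (simp add: mult.assoc)
  qed
  then show ?thesis by blast
qed

lemma infimum_coeff_seminorm:
  fixes N :: "'x \<Rightarrow> ('i \<Rightarrow> real) \<Rightarrow> real"
  assumes ne: "X \<noteq> {}" and nonneg: "\<And>x c. x \<in> X \<Longrightarrow> 0 \<le> N x c"
    and add: "\<And>x y. x \<in> X \<Longrightarrow> y \<in> X \<Longrightarrow> \<exists>z\<in>X. \<forall>c d. N z (\<lambda>i. c i + d i) \<le> N x c + N y d"
    and scale: "\<And>a x. x \<in> X \<Longrightarrow> \<exists>y\<in>X. \<forall>c. N y (\<lambda>i. a * c i) \<le> \<bar>a\<bar> * N x c"
  shows "coeff_seminorm (\<lambda>c. INF x\<in>X. N x c)"
proof -
  have bdd: "bdd_below ((\<lambda>x. N x c) ` X)" for c using nonneg by (auto intro!: bdd_belowI)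
  have near: "\<exists>x\<in>X. N x c < (INF x\<in>X. N x c) + e" if "0 < e" for c e
    using cINF_less_iff[OF ne bdd[of c], of "(INF x\<in>X. N x c) + e"] that by simp
  have "(INF x\<in>X. N x (\<lambda>i. c i + d i)) \<le> (INF x\<in>X. N x c) + (INF x\<in>X. N x d)" for c d
  proof (rule field_le_epsilon)
    fix e :: real assume "0 < e"
    then have e: "0 < e / 2" by simp
    obtain x where x: "x \<in> X" "N x c < (INF x\<in>X. N x c) + e / 2" using near[OF e] by blast
    obtain y where y: "y \<in> X" "N y d < (INF x\<in>X. N x d) + e / 2" using near[OF e] by blast
    obtain z where "z \<in> X" "N z (\<lambda>i. c i + d i) \<le> N x c + N y d" using add[OF x(1) y(1)] by blast
    then have "(INF x\<in>X. N x (\<lambda>i. c i + d i)) \<le> N x c + N y d"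
      using cINF_lower2[OF bdd[of "\<lambda>i. c i + d i"]] by blast
    then show "(INF x\<in>X. N x (\<lambda>i. c i + d i)) \<le> (INF x\<in>X. N x c) + (INF x\<in>X. N x d) + e"
      using x(2) y(2) by simp
  qed
  moreover have "(INF x\<in>X. N x (\<lambda>i. a * c i)) \<le> \<bar>a\<bar> * (INF x\<in>X. N x c)" for a c
  proof (rule field_le_epsilon)
    fix e :: real assume e: "0 < e"
    obtain x where x: "x \<in> X" "N x c < (INF x\<in>X. N x c) + e / (\<bar>a\<bar> + 1)"
      using near[of "e / (\<bar>a\<bar> + 1)"] e by (auto simp: add_nonneg_pos)
    obtain y where "y \<in> X" "N y (\<lambda>i. a * c i) \<le> \<bar>a\<bar> * N x c" using scale[OF x(1)] by blast
    then have "(INF x\<in>X. N x (\<lambda>i. a * c i)) \<le> \<bar>a\<bar> * N x c"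
      using cINF_lower2[OF bdd[of "\<lambda>i. a * c i"]] by blast
    also have "\<dots> \<le> \<bar>a\<bar> * ((INF x\<in>X. N x c) + e / (\<bar>a\<bar> + 1))" using x by (intro mult_left_mono) auto
    also have "\<dots> \<le> \<bar>a\<bar> * (INF x\<in>X. N x c) + e"
    proof -
      have "\<bar>a\<bar> * (e / (\<bar>a\<bar> + 1)) \<le> e" using e by (simp add: field_simps)
      then show ?thesis by (simp add: distrib_left)
    qed
    finally show "(INF x\<in>X. N x (\<lambda>i. a * c i)) \<le> \<bar>a\<bar> * (INF x\<in>X. N x c) + e" .
  qed
  ultimately show ?thesis by (simp add: coeff_seminorm_def)
qed

text \<open>
  The form in which finite dimension is used: the infimum of the family \<open>N\<close> is a seminorm, and it
  vanishes at \<open>c\<close> exactly if \<open>N (x n) c \<longlonglongrightarrow> 0\<close> along some sequence \<open>x\<close>.  In the application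
  \<open>X\<close> consists of all pairs of a source and a solution.
\<close>

lemma finite_dim_le_family:
  fixes N :: "'x \<Rightarrow> ('i \<Rightarrow> real) \<Rightarrow> real"
  assumes ne: "X \<noteq> {}" and nonneg: "\<And>x c. x \<in> X \<Longrightarrow> 0 \<le> N x c"
    and add: "\<And>x y. x \<in> X \<Longrightarrow> y \<in> X \<Longrightarrow> \<exists>z\<in>X. \<forall>c d. N z (\<lambda>i. c i + d i) \<le> N x c + N y d"
    and scale: "\<And>a x. x \<in> X \<Longrightarrow> \<exists>y\<in>X. \<forall>c. N y (\<lambda>i. a * c i) \<le> \<bar>a\<bar> * N x c"
    and Q: "coeff_seminorm Q" and I: "finite I"
    and ker: "\<And>c x. supported I c \<Longrightarrow> (\<And>n::nat. x n \<in> X) \<Longrightarrow> (\<lambda>n. N (x n) c) \<longlonglongrightarrow> 0 \<Longrightarrow> Q c = 0"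
  obtains K where "0 \<le> K" "\<And>x c. x \<in> X \<Longrightarrow> supported I c \<Longrightarrow> Q c \<le> K * N x c"
proof -
  define P where "P c = (INF x\<in>X. N x c)" for c
  have bdd: "bdd_below ((\<lambda>x. N x c) ` X)" for c using nonneg by (auto intro!: bdd_belowI)
  have P: "coeff_seminorm P"
    unfolding P_def using infimum_coeff_seminorm[of X N, OF ne nonneg add scale] by blast
  have le: "P c \<le> N x c" if "x \<in> X" for x c unfolding P_def by (rule cINF_lower[OF bdd that])
  have "Q c = 0" if c: "supported I c" "P c = 0" for c
  proof -
    have "\<exists>x\<in>X. N x c < 1 / Suc n" for n
      using cINF_less_iff[OF ne bdd[of c], of "1 / Suc n"] c(2) by (simp add: P_def)
    then obtain x where x: "\<And>n. x n \<in> X" "\<And>n. N (x n) c < 1 / Suc n" by metis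
    have "(\<lambda>n. N (x n) c) \<longlonglongrightarrow> 0"
    proof (rule tendsto_sandwich[where f="\<lambda>_. 0" and h="\<lambda>n. 1 / Suc n"])
      show "(\<lambda>n. 1 / real (Suc n)) \<longlonglongrightarrow> 0"
        using LIMSEQ_inverse_real_of_nat by (simp add: inverse_eq_divide)
    qed (use x nonneg in \<open>auto intro!: always_eventually less_imp_le\<close>)
    then show ?thesis using ker c x(1) by blast
  qed
  then obtain K where K: "\<And>c. supported I c \<Longrightarrow> Q c \<le> K * P c"
    using finite_dim_seminorm_le[OF P Q I] by blast
  have "Q c \<le> max K 0 * N x c" if "x \<in> X" "supported I c" for x c
  proof -
    have "Q c \<le> K * P c" by (rule K[OF that(2)])
    also have "\<dots> \<le> max K 0 * P c" using coeff_seminorm_nonneg[OF P] by (intro mult_right_mono) auto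
    also have "\<dots> \<le> max K 0 * N x c" using le[OF that(1)] by (intro mult_left_mono) auto
    finally show ?thesis .
  qed
  then show thesis using that[of "max K 0"] by simp
qed

section \<open>The observability estimate\<close>

lemma L2_norm_cong_AE:
  assumes "f \<in> L2 T" "g \<in> L2 T" "AE t in time_measure T. f t = g t"
  shows "L2_norm T f = L2_norm T g"
proof -
  have "(\<integral>t. (norm (f t))\<^sup>2 \<partial>time_measure T) = (\<integral>t. (norm (g t))\<^sup>2 \<partial>time_measure T)"
    using assms by (intro integral_cong_AE) (auto simp: L2_def)
  then show ?thesis by (simp add: L2_norm_def)
qed

definition lin_comb :: "(real \<Rightarrow> 'b) set \<Rightarrow> ((real \<Rightarrow> 'b) \<Rightarrow> real) \<Rightarrow> real \<Rightarrow> 'b::real_normed_vector" where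
  "lin_comb E c t = (\<Sum>e\<in>E. c e *\<^sub>R e t)"

lemma lin_comb_add: "lin_comb E (\<lambda>e. c e + d e) t = lin_comb E c t + lin_comb E d t"
  unfolding lin_comb_def scaleR_add_left sum.distrib ..

lemma lin_comb_scale: "lin_comb E (\<lambda>e. a * c e) t = a *\<^sub>R lin_comb E c t"
  by (simp add: lin_comb_def scaleR_sum_right)

lemma closed_subspace_L2_uminus:
  assumes V: "closed_subspace_L2 T V" and f: "f \<in> V"
  shows "(\<lambda>t. - f t) \<in> V"
proof -
  have "\<forall>c. \<forall>f\<in>V. (\<lambda>t. c *\<^sub>R f t) \<in> V" using V by (simp add: closed_subspace_L2_def)
  then have "(\<lambda>t. (- 1) *\<^sub>R f t) \<in> V" using f by blast
  then show ?thesis by simp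
qed

lemma lin_comb_mem:
  assumes V: "closed_subspace_L2 T V" and E: "finite E" "E \<subseteq> V"
  shows "lin_comb E c \<in> V"
  using E
proof (induction E rule: finite_induct)
  case empty
  then show ?case using V by (simp add: closed_subspace_L2_def lin_comb_def[abs_def])
next
  case (insert e E)
  have "(\<lambda>t. c e *\<^sub>R e t + lin_comb E c t) \<in> V"
    using V insert unfolding closed_subspace_L2_def by simp
  moreover have "lin_comb (insert e E) c = (\<lambda>t. c e *\<^sub>R e t + lin_comb E c t)"
    using insert.hyps by (simp add: lin_comb_def fun_eq_iff)
  ultimately show ?case by simp
qed

lemma bounded_linear_mild_L2:
  assumes T: "0 < T" and C: "bounded_linear C" and z: "mild_for R T x f z"
  shows "(\<lambda>t. C (z t)) \<in> L2 T"
  using z by (intro continuous_imp_L2[OF T] bounded_linear.continuous_on[OF C]) (simp add: mild_for_def)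

text \<open>
  Split \<open>z\<close> into the homogeneous solution \<open>p\<close> with the same final value and the solution \<open>q\<close> with zero
  final value.  Duhamel's formula bounds \<open>q\<close> by the source, and \<open>obs\<close> applies to \<open>p\<close>, whose
  observation is that of \<open>z\<close> up to the observation of \<open>q\<close>.
\<close>

lemma observability_with_source:
  fixes R :: "real \<Rightarrow> 'h \<Rightarrow> 'h::{real_inner, complete_space}"
    and C :: "'h \<Rightarrow> 'u::real_normed_vector"
  assumes R: "C0_semigroup R" and T: "0 < T" and \<tau>: "0 < \<tau>" "\<tau> \<le> T" and C: "bounded_linear C"
    and obs: "\<exists>k. \<forall>x z. mild_for R T x (\<lambda>t. 0) z \<longrightarrow> norm (z \<tau>) \<le> k * L2_norm T (\<lambda>t. C (z t))"
  obtains K where "0 < K"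
    "\<And>x f z. \<lbrakk>f \<in> L2 T; mild_for R T x f z\<rbrakk> \<Longrightarrow> norm (z \<tau>) \<le> K * (L2_norm T (\<lambda>t. C (z t)) + L2_norm T f)"
proof -
  obtain k0 where k0: "\<And>x z. mild_for R T x (\<lambda>t. 0) z \<Longrightarrow> norm (z \<tau>) \<le> k0 * L2_norm T (\<lambda>t. C (z t))"
    using obs by blast
  define k where "k = max k0 0"
  have k: "0 \<le> k" by (simp add: k_def)
  obtain M where M: "0 < M" "\<And>\<sigma> x f z t. \<lbrakk>\<sigma> \<le> T; f \<in> L2 T; mild_for R \<sigma> x f z; t \<in> {0..\<sigma>}\<rbrakk>
      \<Longrightarrow> norm (z t) \<le> M * (norm x + L2_norm T f)"
    using mild_for_bound[OF R T] by blast
  obtain b where b: "0 < b" "\<And>y. norm (C y) \<le> norm y * b" using bounded_linear.pos_bounded[OF C] by blast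
  define K where "K = k + k * (sqrt T * (M * b)) + M"
  have "norm (z \<tau>) \<le> K * (L2_norm T (\<lambda>t. C (z t)) + L2_norm T f)"
    if f: "f \<in> L2 T" and z: "mild_for R T x f z" for x f z
  proof -
    define p where "p t = R (T - t) x" for t
    define q where "q t = z t - p t" for t
    have p: "mild_for R T x (\<lambda>t. 0) p" unfolding p_def by (rule mild_for_homogeneous[OF R])
    have q: "mild_for R T 0 f q" using mild_for_diff[OF R z p] by (simp add: q_def[abs_def])
    have qb: "norm (q t) \<le> M * L2_norm T f" if "t \<in> {0..T}" for t
      using M(2)[OF order_refl f q that] by simp
    have pos: "0 \<le> M * L2_norm T f" using M by (simp add: L2_norm_nonneg)
    have Cq: "L2_norm T (\<lambda>t. C (q t)) \<le> sqrt T * (M * L2_norm T f * b)"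
    proof (rule L2_norm_le_bound[OF T bounded_linear_mild_L2[OF T C q]])
      show "norm (C (q t)) \<le> M * L2_norm T f * b" if "t \<in> {0<..<T}" for t
        using order_trans[OF b(2) mult_right_mono[OF qb]] that b(1) by simp
    qed (use pos b in simp)
    have "norm (p \<tau>) \<le> k0 * L2_norm T (\<lambda>t. C (p t))" by (rule k0[OF p])
    also have "\<dots> \<le> k * L2_norm T (\<lambda>t. C (p t))"
      by (intro mult_right_mono) (auto simp: k_def L2_norm_nonneg)
    also have "(\<lambda>t. C (p t)) = (\<lambda>t. C (z t) - C (q t))"
      by (simp add: q_def linear_simps[OF C])
    also have "L2_norm T (\<lambda>t. C (z t) - C (q t)) \<le> L2_norm T (\<lambda>t. C (z t)) + L2_norm T (\<lambda>t. C (q t))"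
      by (intro L2_norm_diff_triangle bounded_linear_mild_L2[OF T C z] bounded_linear_mild_L2[OF T C q])
    also have "\<dots> \<le> L2_norm T (\<lambda>t. C (z t)) + sqrt T * (M * L2_norm T f * b)" using Cq by simp
    finally have "norm (p \<tau>) \<le> k * (L2_norm T (\<lambda>t. C (z t)) + sqrt T * (M * L2_norm T f * b))"
      using k by (simp add: mult_left_mono)
    moreover have "norm (z \<tau>) \<le> norm (p \<tau>) + norm (q \<tau>)"
      using norm_triangle_ineq[of "p \<tau>" "q \<tau>"] by (simp add: q_def)
    moreover have "norm (q \<tau>) \<le> M * L2_norm T f" using qb[of \<tau>] \<tau> by simp
    ultimately have "norm (z \<tau>) \<le> k * L2_norm T (\<lambda>t. C (z t)) + k * (sqrt T * (M * b)) * L2_norm T f + M * L2_norm T f"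
      by (simp add: algebra_simps)
    also have "\<dots> \<le> K * (L2_norm T (\<lambda>t. C (z t)) + L2_norm T f)"
    proof -
      have "0 \<le> k * (sqrt T * (M * b)) * L2_norm T (\<lambda>t. C (z t))" "0 \<le> M * L2_norm T (\<lambda>t. C (z t))" "0 \<le> k * L2_norm T f"
        using k M b T by (simp_all add: L2_norm_nonneg)
      then show ?thesis unfolding K_def distrib_left distrib_right by linarith
    qed
    finally show ?thesis .
  qed
  moreover have "0 < K" using k M b T by (simp add: K_def add_nonneg_pos)
  ultimately show thesis using that by blast
qed

text \<open>
  No convergence of the final values \<open>X n\<close> is available.  Observability turns the convergence of the
  observations and sources into convergence of \<open>Z n \<tau>\<close>, and the limit is taken on \<open>[0,\<tau>]\<close> only.
\<close>

lemma mild_for_observed_limit: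
  fixes R :: "real \<Rightarrow> 'h \<Rightarrow> 'h::{real_inner, complete_space}"
    and C :: "'h \<Rightarrow> 'u::real_normed_vector"
  assumes R: "C0_semigroup R" and T: "0 < T" and \<tau>: "0 < \<tau>" "\<tau> \<le> T" and C: "bounded_linear C"
    and obs: "\<exists>k. \<forall>x z. mild_for R T x (\<lambda>t. 0) z \<longrightarrow> norm (z \<tau>) \<le> k * L2_norm T (\<lambda>t. C (z t))"
    and f: "\<And>n::nat. F n \<in> L2 T" and z: "\<And>n. mild_for R T (X n) (F n) (Z n)"
    and g: "g \<in> L2 T" and w: "w \<in> L2 T"
    and Cz: "(\<lambda>n. L2_norm T (\<lambda>t. C (Z n t) - g t)) \<longlonglongrightarrow> 0"
    and Fw: "(\<lambda>n. L2_norm T (\<lambda>t. F n t - w t)) \<longlonglongrightarrow> 0"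
  obtains x y where "mild_for R \<tau> x w y" "AE t in time_measure \<tau>. C (y t) = g t"
proof -
  obtain K where K: "0 < K" "\<And>x f z. \<lbrakk>f \<in> L2 T; mild_for R T x f z\<rbrakk>
      \<Longrightarrow> norm (z \<tau>) \<le> K * (L2_norm T (\<lambda>t. C (z t)) + L2_norm T f)"
    using observability_with_source[OF R T \<tau> C obs] by blast
  note CL2 = bounded_linear_mild_L2[OF T C z]
  define e where "e n = L2_norm T (\<lambda>t. C (Z n t) - g t) + L2_norm T (\<lambda>t. F n t - w t)" for n
  have e: "e \<longlonglongrightarrow> 0" unfolding e_def using tendsto_add[OF Cz Fw] by simp
  have close: "norm (Z m \<tau> - Z n \<tau>) \<le> K * (e m + e n)" for m n
  proof -
    have "norm (Z m \<tau> - Z n \<tau>)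
        \<le> K * (L2_norm T (\<lambda>t. C (Z m t - Z n t)) + L2_norm T (\<lambda>t. F m t - F n t))"
      by (rule K(2)[OF L2_diff[OF f f] mild_for_diff[OF R z z]])
    also have "\<dots> \<le> K * (e m + e n)"
    proof (rule mult_left_mono)
      have "L2_norm T (\<lambda>t. (F m t - w t) - (F n t - w t))
          \<le> L2_norm T (\<lambda>t. F m t - w t) + L2_norm T (\<lambda>t. F n t - w t)"
        by (intro L2_norm_diff_triangle L2_diff f w)
      moreover have "L2_norm T (\<lambda>t. (C (Z m t) - g t) - (C (Z n t) - g t))
          \<le> L2_norm T (\<lambda>t. C (Z m t) - g t) + L2_norm T (\<lambda>t. C (Z n t) - g t)"
        by (intro L2_norm_diff_triangle L2_diff CL2 g)
      ultimately show "L2_norm T (\<lambda>t. C (Z m t - Z n t)) + L2_norm T (\<lambda>t. F m t - F n t) \<le> e m + e n"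
        by (simp add: e_def linear_simps[OF C])
    qed (use K in simp)
    finally show ?thesis .
  qed
  have "Cauchy (\<lambda>n. Z n \<tau>)"
  proof (rule metric_CauchyI)
    fix r :: real assume r: "0 < r"
    have "\<forall>\<^sub>F n in sequentially. e n < r / (2 * K)"
      using r K by (intro order_tendstoD(2)[OF e]) simp
    then obtain N where N: "\<And>n. n \<ge> N \<Longrightarrow> e n < r / (2 * K)"
      unfolding eventually_sequentially by blast
    have "dist (Z m \<tau>) (Z n \<tau>) < r" if "m \<ge> N" "n \<ge> N" for m n
    proof -
      have "e m + e n < r / (2 * K) + r / (2 * K)" using N[OF that(1)] N[OF that(2)] by linarith
      then have "K * (e m + e n) < r" using K(1) by (simp add: field_simps)
      then show ?thesis using close[of m n] by (simp add: dist_norm)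
    qed
    then show "\<exists>M. \<forall>m\<ge>M. \<forall>n\<ge>M. dist (Z m \<tau>) (Z n \<tau>) < r" by blast
  qed
  then obtain x where x: "(\<lambda>n. Z n \<tau>) \<longlonglongrightarrow> x" using Cauchy_convergent convergent_def by blast
  have zr: "mild_for R \<tau> (Z n \<tau>) (F n) (Z n)" for n
    using mild_for_restrict[OF R z] \<tau> by simp
  have Fw\<tau>: "(\<lambda>n. L2_norm \<tau> (\<lambda>t. F n t - w t)) \<longlonglongrightarrow> 0"
  proof (rule tendsto_sandwich[OF _ _ tendsto_const Fw])
    show "\<forall>\<^sub>F n in sequentially. L2_norm \<tau> (\<lambda>t. F n t - w t) \<le> L2_norm T (\<lambda>t. F n t - w t)"
      using L2_restrict(2)[OF \<tau>(2) L2_diff[OF f w]] by simp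
  qed (simp add: L2_norm_nonneg)
  obtain y where y: "mild_for R \<tau> x w y" and lim: "uniform_limit {0..\<tau>} Z y sequentially"
    using mild_for_limit[OF R \<tau>(1) zr L2_restrict(1)[OF \<tau>(2) f] L2_restrict(1)[OF \<tau>(2) w] Fw\<tau> x] by blast
  obtain b where b: "0 < b" "\<And>y. norm (C y) \<le> norm y * b" using bounded_linear.pos_bounded[OF C] by blast
  have CyL2: "(\<lambda>t. C (y t)) \<in> L2 \<tau>" by (rule bounded_linear_mild_L2[OF \<tau>(1) C y])
  have g\<tau>: "g \<in> L2 \<tau>" by (rule L2_restrict(1)[OF \<tau>(2) g])
  have "L2_norm \<tau> (\<lambda>t. C (y t) - g t) \<le> 0"
  proof (rule field_le_epsilon)
    fix r :: real assume r: "0 < r"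
    \<comment> \<open>a uniform error of \<open>\<delta>\<close> in the solution costs \<open>r / 2\<close> in the \<open>L\<^sup>2\<close> norm of its observation\<close>
    define \<delta> where "\<delta> = r / 2 / (sqrt \<tau> * b)"
    have \<delta>: "0 < \<delta>" "sqrt \<tau> * (\<delta> * b) = r / 2" using r \<tau> b by (auto simp: \<delta>_def)
    have "\<forall>\<^sub>F n in sequentially. (\<forall>t\<in>{0..\<tau>}. dist (Z n t) (y t) < \<delta>) \<and> L2_norm T (\<lambda>t. C (Z n t) - g t) < r / 2"
      using r \<delta>(1) by (intro eventually_conj uniform_limitD[OF lim] order_tendstoD(2)[OF Cz]) auto
    then obtain n where n: "\<And>t. t \<in> {0..\<tau>} \<Longrightarrow> dist (Z n t) (y t) < \<delta>" "L2_norm T (\<lambda>t. C (Z n t) - g t) < r / 2"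
      unfolding eventually_sequentially by blast
    have CZ\<tau>: "(\<lambda>t. C (Z n t)) \<in> L2 \<tau>" by (rule L2_restrict(1)[OF \<tau>(2) CL2])
    have "L2_norm \<tau> (\<lambda>t. C (Z n t) - C (y t)) \<le> sqrt \<tau> * (\<delta> * b)"
    proof (rule L2_norm_le_bound[OF \<tau>(1) L2_diff[OF CZ\<tau> CyL2]])
      show "norm (C (Z n t) - C (y t)) \<le> \<delta> * b" if "t \<in> {0<..<\<tau>}" for t
      proof -
        have "norm (C (Z n t - y t)) \<le> norm (Z n t - y t) * b" by (rule b(2))
        also have "\<dots> \<le> \<delta> * b" using n(1)[of t] that b(1) by (intro mult_right_mono) (auto simp: dist_norm)
        finally show ?thesis by (simp add: linear_simps[OF C])
      qed
    qed (use \<delta> b in simp)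
    moreover have "L2_norm \<tau> (\<lambda>t. C (Z n t) - g t) \<le> L2_norm T (\<lambda>t. C (Z n t) - g t)"
      by (rule L2_restrict(2)[OF \<tau>(2) L2_diff[OF CL2 g]])
    moreover have "L2_norm \<tau> (\<lambda>t. (C (Z n t) - g t) - (C (Z n t) - C (y t)))
        \<le> L2_norm \<tau> (\<lambda>t. C (Z n t) - g t) + L2_norm \<tau> (\<lambda>t. C (Z n t) - C (y t))"
      by (intro L2_norm_diff_triangle L2_diff CZ\<tau> CyL2 g\<tau>)
    ultimately show "L2_norm \<tau> (\<lambda>t. C (y t) - g t) \<le> 0 + r" using n(2) \<delta>(2) by simp
  qed
  then have "L2_norm \<tau> (\<lambda>t. C (y t) - g t) = 0" using L2_norm_nonneg antisym by blast
  from L2_norm_zero_imp_AE[OF L2_diff[OF CyL2 g\<tau>] this]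
  have "AE t in time_measure \<tau>. C (y t) = g t" by simp
  then show thesis using that y by blast
qed

text \<open>
  The quantity that multiplies \<open>K\<close> is the family \<open>N\<close> of \<open>finite_dim_le_family\<close>, indexed by sources and
  solutions and depending on the coefficients of \<open>g\<close> and \<open>w\<close>.  Where it tends to \<open>0\<close>, the limit
  of the solutions satisfies the premises of \<open>uniq\<close> with \<open>- g\<close> and \<open>- w\<close>.
\<close>

lemma finite_dim_observation:
  fixes R :: "real \<Rightarrow> 'h \<Rightarrow> 'h::{real_inner, complete_space}"
    and C :: "'h \<Rightarrow> 'u::real_normed_vector"
  assumes R: "C0_semigroup R" and T: "0 < T" and \<tau>: "0 < \<tau>" "\<tau> \<le> T" and C: "bounded_linear C"
    and G: "closed_subspace_L2 T G" "finite_dim_L2 T G"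
    and W: "closed_subspace_L2 T W" "finite_dim_L2 T W"
    and uniq: "\<And>x g w z. g \<in> G \<Longrightarrow> w \<in> W \<Longrightarrow> mild_for R \<tau> x w z \<Longrightarrow>
        AE t in time_measure \<tau>. C (z t) = g t \<Longrightarrow>
        (AE t in time_measure T. g t = 0) \<and> (AE t in time_measure T. w t = 0)"
    and obs: "\<exists>k. \<forall>x z. mild_for R T x (\<lambda>t. 0) z \<longrightarrow> norm (z \<tau>) \<le> k * L2_norm T (\<lambda>t. C (z t))"
  obtains K where "0 \<le> K"
    "\<And>g w x f z. \<lbrakk>g \<in> G; w \<in> W; f \<in> L2 T; mild_for R T x f z\<rbrakk> \<Longrightarrow>
      L2_norm T g + L2_norm T w \<le> K * (L2_norm T (\<lambda>t. C (z t) + g t) + L2_norm T (\<lambda>t. f t + w t))"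
proof -
  obtain EG where EG: "finite EG" "EG \<subseteq> G"
    and spanG: "\<And>g. g \<in> G \<Longrightarrow> \<exists>c. AE t in time_measure T. g t = lin_comb EG c t"
    using G(2) unfolding finite_dim_L2_def lin_comb_def by blast
  obtain EW where EW: "finite EW" "EW \<subseteq> W"
    and spanW: "\<And>w. w \<in> W \<Longrightarrow> \<exists>c. AE t in time_measure T. w t = lin_comb EW c t"
    using W(2) unfolding finite_dim_L2_def lin_comb_def by blast
  have GL2: "G \<subseteq> L2 T" and WL2: "W \<subseteq> L2 T" using G W by (auto simp: closed_subspace_L2_def)
  define gc where "gc c = lin_comb EG (\<lambda>e. c (Inl e))" for c :: "(real \<Rightarrow> 'u) + (real \<Rightarrow> 'h) \<Rightarrow> real"
  define wc where "wc c = lin_comb EW (\<lambda>e. c (Inr e))" for c :: "(real \<Rightarrow> 'u) + (real \<Rightarrow> 'h) \<Rightarrow> real"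
  have gcG: "gc c \<in> G" for c unfolding gc_def by (rule lin_comb_mem[OF G(1) EG])
  have wcW: "wc c \<in> W" for c unfolding wc_def by (rule lin_comb_mem[OF W(1) EW])
  have gcL: "gc c \<in> L2 T" and wcL: "wc c \<in> L2 T" for c using gcG wcW GL2 WL2 by blast+
  define X where "X = {(f, z). f \<in> L2 T \<and> (\<exists>x. mild_for R T x f z)}"
  define N where "N y c = (case y of (f, z) \<Rightarrow>
      L2_norm T (\<lambda>t. C (z t) + gc c t) + L2_norm T (\<lambda>t. f t + wc c t))" for y c
  define Q where "Q c = L2_norm T (gc c) + L2_norm T (wc c)" for c
  have CL2: "(\<lambda>t. C (z t) + gc c t) \<in> L2 T" "(\<lambda>t. f t + wc c t) \<in> L2 T" if "(f, z) \<in> X" for f z c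
    using that bounded_linear_mild_L2[OF T C] by (auto simp: X_def intro!: L2_add gcL wcL)
  have Q: "coeff_seminorm Q"
    unfolding coeff_seminorm_def
  proof (intro conjI allI)
    show "Q (\<lambda>i. c i + d i) \<le> Q c + Q d" for c d
      using L2_norm_triangle[OF gcL gcL, of c d] L2_norm_triangle[OF wcL wcL, of c d]
      by (simp add: Q_def gc_def wc_def lin_comb_add[abs_def])
    show "Q (\<lambda>i. a * c i) \<le> \<bar>a\<bar> * Q c" for a c
      by (simp add: Q_def gc_def wc_def lin_comb_scale[abs_def] L2_norm_scaleR distrib_left)
  qed
  have fin: "finite (EG <+> EW)" using EG EW by simp
  obtain K where K: "0 \<le> K" "\<And>y c. y \<in> X \<Longrightarrow> supported (EG <+> EW) c \<Longrightarrow> Q c \<le> K * N y c"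
  proof (rule finite_dim_le_family[of X N Q "EG <+> EW", OF _ _ _ _ Q fin])
    have "(\<lambda>t. 0, \<lambda>t. R (T - t) 0) \<in> X"
      using mild_for_homogeneous[OF R] G(1) W(1) by (auto simp: X_def closed_subspace_L2_def)
    then show "X \<noteq> {}" by blast
    show "0 \<le> N y c" if "y \<in> X" for y c by (auto simp: N_def L2_norm_nonneg split: prod.split)
    show "\<exists>u\<in>X. \<forall>c d. N u (\<lambda>i. c i + d i) \<le> N y c + N v d" if yv: "y \<in> X" "v \<in> X" for y v
    proof -
      obtain f z f' z' where [simp]: "y = (f, z)" "v = (f', z')" by (metis surj_pair)
      have "(\<lambda>t. f t + f' t, \<lambda>t. z t + z' t) \<in> X"
        using yv mild_for_add[OF R] by (auto simp: X_def intro: L2_add) blast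
      moreover have "N (\<lambda>t. f t + f' t, \<lambda>t. z t + z' t) (\<lambda>i. c i + d i) \<le> N y c + N v d" for c d
        using L2_norm_triangle[OF CL2(1)[of f z c] CL2(1)[of f' z' d]] L2_norm_triangle[OF CL2(2)[of f z c] CL2(2)[of f' z' d]] yv
        by (simp add: N_def gc_def wc_def lin_comb_add[abs_def] linear_simps[OF C] add_ac)
      ultimately show ?thesis by blast
    qed
    show "\<exists>v\<in>X. \<forall>c. N v (\<lambda>i. a * c i) \<le> \<bar>a\<bar> * N y c" if y: "y \<in> X" for a y
    proof -
      obtain f z where [simp]: "y = (f, z)" by (metis surj_pair)
      have "(\<lambda>t. a *\<^sub>R f t, \<lambda>t. a *\<^sub>R z t) \<in> X"
        using y mild_for_scaleR[OF R] by (auto simp: X_def intro: L2_scaleR) blast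
      moreover have "N (\<lambda>t. a *\<^sub>R f t, \<lambda>t. a *\<^sub>R z t) (\<lambda>i. a * c i) \<le> \<bar>a\<bar> * N y c" for c
        by (simp add: N_def gc_def wc_def lin_comb_scale[abs_def] linear_simps[OF C] scaleR_add_right[symmetric]
            L2_norm_scaleR distrib_left)
      ultimately show ?thesis by blast
    qed
    show "Q c = 0" if x: "\<And>n::nat. y n \<in> X" and lim: "(\<lambda>n. N (y n) c) \<longlonglongrightarrow> 0" for c y
    proof -
      define F where "F n = fst (y n)" for n
      define Z where "Z n = snd (y n)" for n
      have y: "y n = (F n, Z n)" for n by (simp add: F_def Z_def)
      have F: "F n \<in> L2 T" for n using x[of n] by (simp add: X_def y)
      have "\<forall>n. \<exists>x. mild_for R T x (F n) (Z n)" using x by (simp add: X_def y)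
      then obtain \<xi> where Z: "\<And>n. mild_for R T (\<xi> n) (F n) (Z n)" by metis
      have neg: "(\<lambda>t. - gc c t) \<in> G" "(\<lambda>t. - wc c t) \<in> W"
        using closed_subspace_L2_uminus[OF G(1) gcG] closed_subspace_L2_uminus[OF W(1) wcW] by auto
      then have negL: "(\<lambda>t. - gc c t) \<in> L2 T" "(\<lambda>t. - wc c t) \<in> L2 T" using GL2 WL2 by auto
      have l1: "(\<lambda>n. L2_norm T (\<lambda>t. C (Z n t) - (- gc c t))) \<longlonglongrightarrow> 0"
        by (rule tendsto_sandwich[OF _ _ tendsto_const lim]) (auto simp: N_def y L2_norm_nonneg)
      have l2: "(\<lambda>n. L2_norm T (\<lambda>t. F n t - (- wc c t))) \<longlonglongrightarrow> 0"
        by (rule tendsto_sandwich[OF _ _ tendsto_const lim]) (auto simp: N_def y L2_norm_nonneg)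
      obtain x0 y0 where "mild_for R \<tau> x0 (\<lambda>t. - wc c t) y0" "AE t in time_measure \<tau>. C (y0 t) = - gc c t"
        using mild_for_observed_limit[OF R T \<tau> C obs F Z negL l1 l2] by blast
      from uniq[OF neg this]
      have "AE t in time_measure T. gc c t = 0" "AE t in time_measure T. wc c t = 0" by simp_all
      then show ?thesis by (simp add: Q_def AE_imp_L2_norm_zero)
    qed
  qed blast
  have "L2_norm T g + L2_norm T w \<le> K * (L2_norm T (\<lambda>t. C (z t) + g t) + L2_norm T (\<lambda>t. f t + w t))"
    if gw: "g \<in> G" "w \<in> W" and f: "f \<in> L2 T" and z: "mild_for R T x f z" for g w x f z
  proof -
    obtain a where a: "AE t in time_measure T. g t = lin_comb EG a t" using spanG[OF gw(1)] by blast
    obtain b where b: "AE t in time_measure T. w t = lin_comb EW b t" using spanW[OF gw(2)] by blast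
    define c where "c i = (case i of Inl e \<Rightarrow> if e \<in> EG then a e else 0 | Inr e \<Rightarrow> if e \<in> EW then b e else 0)" for i
    have supp: "supported (EG <+> EW) c" by (auto simp: supported_def c_def split: sum.split)
    have "gc c = lin_comb EG a" "wc c = lin_comb EW b"
      by (auto simp: gc_def wc_def c_def lin_comb_def[abs_def] intro!: ext sum.cong)
    then have ae: "AE t in time_measure T. g t = gc c t" "AE t in time_measure T. w t = wc c t"
      using a b by simp_all
    have y: "(f, z) \<in> X" using f z by (auto simp: X_def)
    have gwL: "g \<in> L2 T" "w \<in> L2 T" using gw GL2 WL2 by auto
    have "L2_norm T g = L2_norm T (gc c)" "L2_norm T w = L2_norm T (wc c)"
      by (rule L2_norm_cong_AE; use gwL gcL wcL ae in simp)+
    moreover have "L2_norm T (\<lambda>t. C (z t) + g t) = L2_norm T (\<lambda>t. C (z t) + gc c t)"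
      using ae(1) by (intro L2_norm_cong_AE CL2(1)[OF y] L2_add bounded_linear_mild_L2[OF T C z] gwL) auto
    moreover have "L2_norm T (\<lambda>t. f t + w t) = L2_norm T (\<lambda>t. f t + wc c t)"
      using ae(2) by (intro L2_norm_cong_AE CL2(2)[OF y] L2_add f gwL) auto
    ultimately show ?thesis using K(2)[OF y supp] by (simp add: Q_def N_def)
  qed
  then show thesis using that K(1) by blast
qed

lemma sqrt_sum_squares4_le:
  fixes a b c d :: real
  assumes "0 \<le> a" "0 \<le> b" "0 \<le> c" "0 \<le> d"
  shows "sqrt (a\<^sup>2 + b\<^sup>2 + c\<^sup>2 + d\<^sup>2) \<le> a + b + c + d"
proof (rule real_le_lsqrt)
  show "a\<^sup>2 + b\<^sup>2 + c\<^sup>2 + d\<^sup>2 \<le> (a + b + c + d)\<^sup>2"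
    using assms by (simp add: power2_eq_square algebra_simps)
qed (use assms in auto)

theorem proposition1p5:
  fixes A :: "('h::{real_inner, complete_space} \<times> 'h) set"
    and B :: "'u::{real_inner, complete_space} \<Rightarrow> 'h"
    and T \<tau> :: real
    and G :: "(real \<Rightarrow> 'u) set"
    and W :: "(real \<Rightarrow> 'h) set"
  assumes A: "\<exists>S. generates A S"
    and B: "bounded_linear B"
    and T: "0 < T"
    and G: "closed_subspace_L2 T G" "finite_dim_L2 T G"
    and W: "closed_subspace_L2 T W" "finite_dim_L2 T W"
    and tau: "0 < \<tau>" "\<tau> \<le> T"
    and i: "\<And>z\<^sub>\<tau> g w z. g \<in> G \<Longrightarrow> w \<in> W \<Longrightarrow> mild_solution (adjoint_graph A) \<tau> z\<^sub>\<tau> w z \<Longrightarrow>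
              AE t in time_measure \<tau>. adjoint B (z t) = g t \<Longrightarrow>
              z\<^sub>\<tau> = 0 \<and> (AE t in time_measure T. g t = 0) \<and> (AE t in time_measure T. w t = 0)"
    and ii: "\<exists>C. \<forall>z\<^sub>T z. mild_solution (adjoint_graph A) T z\<^sub>T (\<lambda>t. 0) z \<longrightarrow>
              norm (z \<tau>) \<le> C * L2_norm T (\<lambda>t. adjoint B (z t))"
  shows "\<exists>C>0. \<forall>z\<^sub>T. \<forall>g\<in>G. \<forall>w\<in>W. \<forall>f\<in>L2 T. \<forall>z. mild_solution (adjoint_graph A) T z\<^sub>T f z \<longrightarrow>
           sqrt ((norm (z 0))\<^sup>2 + (L2_norm T g)\<^sup>2 + (L2_norm T w)\<^sup>2 + (L2_norm T f)\<^sup>2)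
             \<le> C * (L2_norm T (\<lambda>t. adjoint B (z t) + g t) + L2_norm T (\<lambda>t. f t + w t))"
proof (cases "\<exists>R. generates (adjoint_graph A) R")
  case False
  \<comment> \<open>without a semigroup there are no mild solutions\<close>
  then show ?thesis by (intro exI[of _ 1]) (auto simp: mild_solution_def)
next
  case True
  then obtain R where gen: "generates (adjoint_graph A) R" by blast
  then have R: "C0_semigroup R" by (simp add: generates_def)
  \<comment> \<open>From here on every solution is driven by this \<open>R\<close>, so that the constants do not depend on the solution.\<close>
  note iff = mild_solution_iff_mild_for[OF gen]
  define C where "C = adjoint B"
  have C: "bounded_linear C" unfolding C_def by (rule bounded_linear_adjoint[OF B])
  have obs: "\<exists>k. \<forall>x z. mild_for R T x (\<lambda>t. 0) z \<longrightarrow> norm (z \<tau>) \<le> k * L2_norm T (\<lambda>t. C (z t))"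
    using ii unfolding iff C_def .
  have uniq: "(AE t in time_measure T. g t = 0) \<and> (AE t in time_measure T. w t = 0)"
    if "g \<in> G" "w \<in> W" "mild_for R \<tau> x w z" "AE t in time_measure \<tau>. C (z t) = g t" for x g w z
    using i[OF that(1,2)] that(3,4) unfolding iff C_def by blast
  obtain K1 where K1: "0 \<le> K1" "\<And>g w x f z. \<lbrakk>g \<in> G; w \<in> W; f \<in> L2 T; mild_for R T x f z\<rbrakk> \<Longrightarrow>
      L2_norm T g + L2_norm T w \<le> K1 * (L2_norm T (\<lambda>t. C (z t) + g t) + L2_norm T (\<lambda>t. f t + w t))"
  proof (rule finite_dim_observation[OF R T tau C G W _ obs])
    show "(AE t in time_measure T. g t = 0) \<and> (AE t in time_measure T. w t = 0)"
      if "g \<in> G" "w \<in> W" "mild_for R \<tau> x w z" "AE t in time_measure \<tau>. C (z t) = g t" for x g w z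
      by (rule uniq[OF that])
  qed blast
  obtain K2 where K2: "0 < K2" "\<And>x f z. \<lbrakk>f \<in> L2 T; mild_for R T x f z\<rbrakk>
      \<Longrightarrow> norm (z \<tau>) \<le> K2 * (L2_norm T (\<lambda>t. C (z t)) + L2_norm T f)"
    using observability_with_source[OF R T tau C obs] by blast
  obtain K3 where K3: "0 < K3" "\<And>\<sigma> x f z t. \<lbrakk>\<sigma> \<le> T; f \<in> L2 T; mild_for R \<sigma> x f z; t \<in> {0..\<sigma>}\<rbrakk>
      \<Longrightarrow> norm (z t) \<le> K3 * (norm x + L2_norm T f)"
    using mild_for_bound[OF R T] by blast
  define K where "K = K3 * (K2 * (2 * (1 + K1)) + (1 + K1)) + K1 + (1 + K1)"
  have "sqrt ((norm (z 0))\<^sup>2 + (L2_norm T g)\<^sup>2 + (L2_norm T w)\<^sup>2 + (L2_norm T f)\<^sup>2)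
      \<le> K * (L2_norm T (\<lambda>t. C (z t) + g t) + L2_norm T (\<lambda>t. f t + w t))"
    if gw: "g \<in> G" "w \<in> W" and f: "f \<in> L2 T" and z: "mild_for R T x f z" for x g w f z
  proof -
    define E where "E = L2_norm T (\<lambda>t. C (z t) + g t) + L2_norm T (\<lambda>t. f t + w t)"
    have gwL: "g \<in> L2 T" "w \<in> L2 T" using gw G W by (auto simp: closed_subspace_L2_def)
    have CzL: "(\<lambda>t. C (z t)) \<in> L2 T" by (rule bounded_linear_mild_L2[OF T C z])
    have gw_le: "L2_norm T g + L2_norm T w \<le> K1 * E" unfolding E_def by (rule K1(2)[OF gw f z])
    note nn = L2_norm_nonneg[of T g] L2_norm_nonneg[of T w]
      L2_norm_nonneg[of T "\<lambda>t. C (z t) + g t"] L2_norm_nonneg[of T "\<lambda>t. f t + w t"]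
    have f_le: "L2_norm T f \<le> (1 + K1) * E"
      using L2_norm_diff_triangle[OF L2_add[OF f gwL(2)] gwL(2)] gw_le nn by (simp add: E_def distrib_right)
    have Cz_le: "L2_norm T (\<lambda>t. C (z t)) \<le> (1 + K1) * E"
      using L2_norm_diff_triangle[OF L2_add[OF CzL gwL(1)] gwL(1)] gw_le nn by (simp add: E_def distrib_right)
    have "norm (z \<tau>) \<le> K2 * (L2_norm T (\<lambda>t. C (z t)) + L2_norm T f)" by (rule K2(2)[OF f z])
    also have "\<dots> \<le> K2 * (2 * (1 + K1) * E)"
    proof (rule mult_left_mono)
      show "L2_norm T (\<lambda>t. C (z t)) + L2_norm T f \<le> 2 * (1 + K1) * E" using f_le Cz_le by linarith
    qed (use K2 in simp)
    finally have z\<tau>: "norm (z \<tau>) \<le> K2 * (2 * (1 + K1) * E)" .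
    have "norm (z 0) \<le> K3 * (norm (z \<tau>) + L2_norm T f)"
      using K3(2)[OF tau(2) f mild_for_restrict[OF R z]] tau by simp
    also have "\<dots> \<le> K3 * (K2 * (2 * (1 + K1) * E) + (1 + K1) * E)"
      using K3 z\<tau> f_le by (intro mult_left_mono) auto
    finally have z0: "norm (z 0) \<le> K3 * (K2 * (2 * (1 + K1) * E) + (1 + K1) * E)" .
    have "sqrt ((norm (z 0))\<^sup>2 + (L2_norm T g)\<^sup>2 + (L2_norm T w)\<^sup>2 + (L2_norm T f)\<^sup>2)
        \<le> norm (z 0) + L2_norm T g + L2_norm T w + L2_norm T f"
      by (intro sqrt_sum_squares4_le) (simp_all add: L2_norm_nonneg)
    also have "\<dots> \<le> K3 * (K2 * (2 * (1 + K1) * E) + (1 + K1) * E) + K1 * E + (1 + K1) * E"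
      using z0 gw_le f_le by linarith
    also have "\<dots> = K * E" by (simp add: K_def algebra_simps)
    finally show ?thesis by (simp add: E_def)
  qed
  moreover have "0 < K"
  proof -
    have "0 \<le> K3 * (K2 * (2 * (1 + K1)) + (1 + K1))" using K1 K2 K3 by simp
    then show ?thesis using K1(1) unfolding K_def by linarith
  qed
  ultimately show ?thesis unfolding iff C_def by (intro exI[of _ K]) blast
qed

end
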